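(* Let $p\ge 0$, $C_A\ge 1$, $C_\kappa>0$ and $\alpha\ge 0$ with $\alpha p<1/2$. There exists a constant $C_{\alpha,A,\kappa}>0$ depending only on $\alpha,p,C_A$ and $C_\kappa$ such that the following holds. For every $D\ge 1$, every $\delta>0$, every sequence $1\ge\lambda_1\ge\dots\ge\lambda_D>0$ with $C_A^{-1}i^{-p}\le\lambda_i\le C_A i^{-p}$ for $i=1,\dots,D$, every $\kappa>0$ with $\big|\kappa-\sum_{i=1}^D\lambda_i^{2\alpha}\delta^2\big|\le C_\kappa s_D\delta^2$, and every $\mu\in\mathbb{R}^D$, $$\mathbb{E}\|\widehat{\mu}^{(\tau_\alpha)}-\mu\|^2\le C_{\alpha,A,\kappa}\Big(\mathbb{E}\|\widehat{\mu}^{(t^{\mathfrak b})}-\mu\|^2+s_D^{(2p+1)/(1-2\alpha p)}\delta^2\Big).$$ Moreover, when $t^{\mathfrak b}\gtrsim s_D^{1/(1-2\alpha p)}$ the risk at $\tau_\alpha$ is of the order of the balanced-oracle risk: for every $c>0$ there is a constant $C'$ depending only on $c,\alpha,p,C_A,C_\kappa$ such that, in the same setting, $t^{\mathfrak b}\ge c\,s_D^{1/(1-2\alpha p)}$ implies $\mathbb{E}\|\widehat{\mu}^{(\tau_\alpha)}-\mu\|^2\le C'\,\mathbb{E}\|\widehat{\mu}^{(t^{\mathfrak b})}-\mu\|^2$.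
   Context: Model: one observes $Y_i=\lambda_i\mu_i+\delta\varepsilon_i$, $i=1,\dots,D$, where $\varepsilon_1,\dots,\varepsilon_D$ are independent standard Gaussian random variables, $\delta>0$ is the noise level, $\mu\in\mathbb{R}^D$ is the unknown signal and $\lambda_1\ge\dots\ge\lambda_D>0$, $\lambda_i\le 1$. $\|\cdot\|$ is the Euclidean norm. $s_D>0$ is defined by $s_D^2=2\sum_{i=1}^D\lambda_i^{4\alpha}$. Estimators: for $t\in[0,D]$ let $\widehat{\mu}^{(t)}_i=(\mathbf{1}\{i\le\lfloor t\rfloor\}+\xi_t\mathbf{1}\{i=\lceil t\rceil\})\lambda_i^{-1}Y_i$, $i=1,\dots,D$, where $\xi_t$ are Bernoulli random variables with success probability $t-\lfloor t\rfloor$, independent of everything else. For integer $m$ this is $\widehat{\mu}^{(m)}_i=\mathbf{1}\{i\le m\}\lambda_i^{-1}Y_i$. Stopping time: for integers $0\le m\le D$, $R^2_{m,\alpha}=\sum_{i=m+1}^D\lambda_i^{2\alpha}Y_i^2$ and $\tau_\alpha=\inf\{m\in\mathbb{N}\cup\{0\}:R^2_{m,\alpha}\le\kappa\}$. Bias and variance: for $t\in[0,D]$, $B_t^2(\mu)=(\lceil t\rceil-t)\mu_{\lceil t\rceil}^2+\sum_{i=\lceil t\rceil+1}^D\mu_i^2$ and $V_t=\sum_{i=1}^{\lfloor t\rfloor}\lambda_i^{-2}\delta^2+(t-\lfloor t\rfloor)\lambda_{\lceil t\rceil}^{-2}\delta^2$ (terms with zero coefficient are omitted, so no index $0$ occurs).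 The balanced oracle is $t^{\mathfrak b}=t^{\mathfrak b}(\mu)=\inf\{t\ge 0:B_t^2(\mu)\le V_t\}$. *)

theory Defs
  imports "HOL-Probability.Probability"
begin

text \<open>
  Vectors indexed by \<open>i = 1, \<dots>, D\<close> are functions \<open>nat \<Rightarrow> real\<close> that are only ever inspected on
  \<open>{1..D}\<close>. The singular values are \<open>l\<close>, the signal is \<open>\<mu>\<close> and the noise level is \<open>\<delta>\<close>.
\<close>

definition s_D :: "real \<Rightarrow> nat \<Rightarrow> (nat \<Rightarrow> real) \<Rightarrow> real" where
  "s_D \<alpha> D l = sqrt (2 * (\<Sum>i=1..D. l i powr (4 * \<alpha>)))"

definition setting ::
  "real \<Rightarrow> real \<Rightarrow> real \<Rightarrow> real \<Rightarrow> nat \<Rightarrow> real \<Rightarrow> (nat \<Rightarrow> real) \<Rightarrow> real \<Rightarrow> bool" where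
  "setting p C\<^sub>A C\<^sub>\<kappa> \<alpha> D \<delta> l \<kappa> \<longleftrightarrow>
     D \<ge> 1 \<and> \<delta> > 0 \<and>
     (\<forall>i\<in>{1..D}. 0 < l i \<and> l i \<le> 1) \<and>
     (\<forall>i\<in>{1..D}. \<forall>j\<in>{1..D}. i \<le> j \<longrightarrow> l j \<le> l i) \<and>
     (\<forall>i\<in>{1..D}. inverse C\<^sub>A * real i powr (- p) \<le> l i \<and> l i \<le> C\<^sub>A * real i powr (- p)) \<and>
     \<kappa> > 0 \<and>
     \<bar>\<kappa> - (\<Sum>i=1..D. l i powr (2 * \<alpha>) * \<delta>\<^sup>2)\<bar> \<le> C\<^sub>\<kappa> * s_D \<alpha> D l * \<delta>\<^sup>2"

definition observation ::
  "(nat \<Rightarrow> real) \<Rightarrow> real \<Rightarrow> (nat \<Rightarrow> real) \<Rightarrow> (nat \<Rightarrow> real) \<Rightarrow> nat \<Rightarrow> real" where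
  "observation l \<delta> \<mu> e i = l i * \<mu> i + \<delta> * e i"

text \<open>In \<open>estimator l Y x t\<close> the outcome \<open>x t\<close> is the value of the Bernoulli variable \<open>\<xi>\<^sub>t\<close>.
  For integer \<open>t\<close> it is almost surely \<open>False\<close>, so only the first indicator remains.\<close>

definition estimator ::
  "(nat \<Rightarrow> real) \<Rightarrow> (nat \<Rightarrow> real) \<Rightarrow> (real \<Rightarrow> bool) \<Rightarrow> real \<Rightarrow> nat \<Rightarrow> real" where
  "estimator l Y x t i =
     (of_bool (int i \<le> \<lfloor>t\<rfloor>) + of_bool (x t) * of_bool (int i = \<lceil>t\<rceil>)) * inverse (l i) * Y i"

definition residual :: "real \<Rightarrow> nat \<Rightarrow> (nat \<Rightarrow> real) \<Rightarrow> (nat \<Rightarrow> real) \<Rightarrow> nat \<Rightarrow> real" where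
  "residual \<alpha> D l Y m = (\<Sum>i=m+1..D. l i powr (2 * \<alpha>) * (Y i)\<^sup>2)"

definition stopping_time :: "real \<Rightarrow> nat \<Rightarrow> (nat \<Rightarrow> real) \<Rightarrow> real \<Rightarrow> (nat \<Rightarrow> real) \<Rightarrow> nat" where
  "stopping_time \<alpha> D l \<kappa> Y = Inf {m. m \<le> D \<and> residual \<alpha> D l Y m \<le> \<kappa>}"

text \<open>
  At \<open>t = 0\<close> the junk values \<open>\<mu> 0\<close> and \<open>l 0\<close> below have coefficient \<open>0\<close>.
\<close>

definition bias2 :: "nat \<Rightarrow> (nat \<Rightarrow> real) \<Rightarrow> real \<Rightarrow> real" where
  "bias2 D \<mu> t =
     (of_int \<lceil>t\<rceil> - t) * (\<mu> (nat \<lceil>t\<rceil>))\<^sup>2 + (\<Sum>i = nat \<lceil>t\<rceil> + 1..D. (\<mu> i)\<^sup>2)"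

definition variance_term :: "(nat \<Rightarrow> real) \<Rightarrow> real \<Rightarrow> real \<Rightarrow> real" where
  "variance_term l \<delta> t =
     (\<Sum>i=1..nat \<lfloor>t\<rfloor>. inverse ((l i)\<^sup>2) * \<delta>\<^sup>2)
     + (t - of_int \<lfloor>t\<rfloor>) * inverse ((l (nat \<lceil>t\<rceil>))\<^sup>2) * \<delta>\<^sup>2"

definition balanced_oracle ::
  "nat \<Rightarrow> (nat \<Rightarrow> real) \<Rightarrow> real \<Rightarrow> (nat \<Rightarrow> real) \<Rightarrow> real" where
  "balanced_oracle D l \<delta> \<mu> = Inf {t \<in> {0..real D}. bias2 D \<mu> t \<le> variance_term l \<delta> t}"

text \<open>
  The joint law of the noise \<open>(\<epsilon>\<^sub>i)\<close>, \<open>i = 1, \<dots>, D\<close>, and of the randomisation \<open>(\<xi>\<^sub>t)\<close>,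
  \<open>t \<in> [0, D]\<close>. Expectations in the model depend on the underlying probability space only through
  this law; see \<open>expected_loss_eq_risk\<close> below.
\<close>

definition noise_law :: "nat \<Rightarrow> ((nat \<Rightarrow> real) \<times> (real \<Rightarrow> bool)) measure" where
  "noise_law D =
     (\<Pi>\<^sub>M i\<in>{1..D}. density lborel std_normal_density)
     \<Otimes>\<^sub>M (\<Pi>\<^sub>M t\<in>{0..real D}. measure_pmf (bernoulli_pmf (t - of_int \<lfloor>t\<rfloor>)))"

definition loss ::
  "nat \<Rightarrow> (nat \<Rightarrow> real) \<Rightarrow> real \<Rightarrow> (nat \<Rightarrow> real) \<Rightarrow> ((nat \<Rightarrow> real) \<Rightarrow> real)
    \<Rightarrow> (nat \<Rightarrow> real) \<Rightarrow> (real \<Rightarrow> bool) \<Rightarrow> real" where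
  "loss D l \<delta> \<mu> T e x =
     (let Y = observation l \<delta> \<mu> e
      in (L2_set (\<lambda>i. estimator l Y x (T Y) i - \<mu> i) {1..D})\<^sup>2)"

text \<open>
  The mean squared error of the estimator with index \<open>T Y\<close>, which is allowed to depend on the data;
  a deterministic index is the constant function.
\<close>

definition risk ::
  "nat \<Rightarrow> (nat \<Rightarrow> real) \<Rightarrow> real \<Rightarrow> (nat \<Rightarrow> real) \<Rightarrow> ((nat \<Rightarrow> real) \<Rightarrow> real) \<Rightarrow> real" where
  "risk D l \<delta> \<mu> T = (\<integral>(e, x). loss D l \<delta> \<mu> T e x \<partial>noise_law D)"

definition stopped_risk ::
  "real \<Rightarrow> nat \<Rightarrow> (nat \<Rightarrow> real) \<Rightarrow> real \<Rightarrow> real \<Rightarrow> (nat \<Rightarrow> real) \<Rightarrow> real" where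
  "stopped_risk \<alpha> D l \<delta> \<kappa> \<mu> = risk D l \<delta> \<mu> (\<lambda>Y. real (stopping_time \<alpha> D l \<kappa> Y))"

definition oracle_risk :: "nat \<Rightarrow> (nat \<Rightarrow> real) \<Rightarrow> real \<Rightarrow> (nat \<Rightarrow> real) \<Rightarrow> real" where
  "oracle_risk D l \<delta> \<mu> = risk D l \<delta> \<mu> (\<lambda>_. balanced_oracle D l \<delta> \<mu>)"

lemma stopping_time_restrict:
  "stopping_time \<alpha> D l \<kappa> (restrict Y {1..D}) = stopping_time \<alpha> D l \<kappa> Y"
proof -
  have "residual \<alpha> D l (restrict Y {1..D}) m = residual \<alpha> D l Y m" for m
    unfolding residual_def by (intro sum.cong) auto
  then show ?thesis by (simp add: stopping_time_def)
qed

lemma stopping_time_le: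
  assumes "\<kappa> > 0"
  shows "stopping_time \<alpha> D l \<kappa> Y \<le> D"
proof -
  have "D \<in> {m. m \<le> D \<and> residual \<alpha> D l Y m \<le> \<kappa>}"
    using assms by (simp add: residual_def)
  then show ?thesis unfolding stopping_time_def by (rule cInf_lower) simp
qed

lemma measurable_residual:
  "(\<lambda>Y. residual \<alpha> D l Y m) \<in> borel_measurable (\<Pi>\<^sub>M i\<in>{1..D}. borel)"
  unfolding residual_def
proof (rule borel_measurable_sum)
  fix i assume "i \<in> {m + 1..D}"
  then have "i \<in> {1..D}" by simp
  then have "(\<lambda>Y. Y i) \<in> borel_measurable (\<Pi>\<^sub>M i\<in>{1..D}. borel :: real measure)"
    by (rule measurable_component_singleton)
  then show "(\<lambda>Y. l i powr (2 * \<alpha>) * (Y i)\<^sup>2) \<in> borel_measurable (\<Pi>\<^sub>M i\<in>{1..D}. borel)"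
    by (intro borel_measurable_times borel_measurable_const borel_measurable_power)
qed

lemma measurable_stopping_time:
  "stopping_time \<alpha> D l \<kappa> \<in> measurable (\<Pi>\<^sub>M i\<in>{1..D}. borel) (count_space UNIV)"
proof -
  have "Measurable.pred borel (\<lambda>r::real. m \<le> D \<and> r \<le> \<kappa>)" for m
    by measurable
  from measurable_compose[OF measurable_residual this]
  have "Measurable.pred (\<Pi>\<^sub>M i\<in>{1..D}. borel) (\<lambda>Y. m \<le> D \<and> residual \<alpha> D l Y m \<le> \<kappa>)" for m .
  from measurable_Least[OF this]
  show ?thesis unfolding stopping_time_def [abs_def] Inf_nat_def mem_Collect_eq .
qed

text \<open>
  The expectation of the loss on an arbitrary probability space that carries the model is the
  risk. The assumption \<open>eps_xi\<close> is independence of \<open>\<epsilon>\<close> and \<open>\<xi>\<close>, written as factorisation of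
  their joint law because \<open>indep_var\<close> requires both variables to have the same value type. The
  assumptions on \<open>T\<close> hold for \<open>stopping_time\<close> with \<open>A = real ` {0..D}\<close> and for
  constants \<open>t \<in> [0, D]\<close> with \<open>A = {t}\<close>.
\<close>

lemma expected_loss_eq_risk:
  fixes \<epsilon> :: "nat \<Rightarrow> 'a \<Rightarrow> real" and \<xi> :: "real \<Rightarrow> 'a \<Rightarrow> bool"
  assumes M: "prob_space M" and D: "D \<ge> 1"
    and eps: "prob_space.indep_vars M (\<lambda>_. borel) \<epsilon> {1..D}"
    and xi: "prob_space.indep_vars M (\<lambda>_. count_space UNIV) \<xi> {0..real D}"
    and eps_xi: "distr M ((\<Pi>\<^sub>M i\<in>{1..D}. borel) \<Otimes>\<^sub>M (\<Pi>\<^sub>M t\<in>{0..real D}. count_space UNIV))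
        (\<lambda>\<omega>. (restrict (\<lambda>i::nat. \<epsilon> i \<omega>) {1..D}, restrict (\<lambda>t::real. \<xi> t \<omega>) {0..real D}))
      = distr M (\<Pi>\<^sub>M i\<in>{1..D}. borel) (\<lambda>\<omega>. restrict (\<lambda>i::nat. \<epsilon> i \<omega>) {1..D})
        \<Otimes>\<^sub>M distr M (\<Pi>\<^sub>M t\<in>{0..real D}. count_space UNIV)
              (\<lambda>\<omega>. restrict (\<lambda>t::real. \<xi> t \<omega>) {0..real D})"
    and eps_law: "\<And>i. i \<in> {1..D} \<Longrightarrow> distr M borel (\<epsilon> i) = density lborel std_normal_density"
    and xi_law: "\<And>t. t \<in> {0..real D} \<Longrightarrow>
      distr M (count_space UNIV) (\<xi> t) = measure_pmf (bernoulli_pmf (t - of_int \<lfloor>t\<rfloor>))"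
    and T: "T \<in> measurable (\<Pi>\<^sub>M i\<in>{1..D}. borel) (count_space A)"
    and T_restrict: "\<And>Y. T (restrict Y {1..D}) = T Y"
    and A: "countable A" "A \<subseteq> {0..real D}"
  shows "(\<integral>\<omega>. loss D l \<delta> \<mu> T (\<lambda>i::nat. \<epsilon> i \<omega>) (\<lambda>t::real. \<xi> t \<omega>) \<partial>M) = risk D l \<delta> \<mu> T"
proof -
  interpret prob_space M by fact
  let ?E = "\<Pi>\<^sub>M i\<in>{1..D}. (borel :: real measure)"
  let ?X = "\<Pi>\<^sub>M t\<in>{0..real D}. (count_space UNIV :: bool measure)"
  let ?e = "\<lambda>\<omega>. restrict (\<lambda>i::nat. \<epsilon> i \<omega>) {1..D}" and ?x = "\<lambda>\<omega>. restrict (\<lambda>t::real. \<xi> t \<omega>) {0..real D}"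
  have e_law: "distr M ?E ?e = (\<Pi>\<^sub>M i\<in>{1..D}. density lborel std_normal_density)"
  proof -
    have "distr M ?E ?e = (\<Pi>\<^sub>M i\<in>{1..D}. distr M borel (\<epsilon> i))"
    proof (rule indep_vars_iff_distr_eq_PiM'[THEN iffD1, OF _ _ eps])
      show "{1..D} \<noteq> {}" using D by simp
      show "\<epsilon> i \<in> borel_measurable M" if "i \<in> {1..D}" for i
        using eps that unfolding indep_vars_def2 by blast
    qed
    also have "\<dots> = (\<Pi>\<^sub>M i\<in>{1..D}. density lborel std_normal_density)"
      by (intro PiM_cong refl eps_law)
    finally show ?thesis .
  qed
  have x_law: "distr M ?X ?x =
      (\<Pi>\<^sub>M t\<in>{0..real D}. measure_pmf (bernoulli_pmf (t - of_int \<lfloor>t\<rfloor>)))"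
  proof -
    have "distr M ?X ?x = (\<Pi>\<^sub>M t\<in>{0..real D}. distr M (count_space UNIV) (\<xi> t))"
    proof (rule indep_vars_iff_distr_eq_PiM'[THEN iffD1, OF _ _ xi])
      show "{0..real D} \<noteq> {}" by simp
      show "\<xi> t \<in> measurable M (count_space UNIV)" if "t \<in> {0..real D}" for t
        using xi that unfolding indep_vars_def2 by blast
    qed
    also have "\<dots> = (\<Pi>\<^sub>M t\<in>{0..real D}. measure_pmf (bernoulli_pmf (t - of_int \<lfloor>t\<rfloor>)))"
      by (intro PiM_cong refl xi_law)
    finally show ?thesis .
  qed
  have law: "distr M (?E \<Otimes>\<^sub>M ?X) (\<lambda>\<omega>. (?e \<omega>, ?x \<omega>)) = noise_law D"
    unfolding eps_xi e_law x_law noise_law_def ..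
  have rv: "?e \<in> measurable M ?E" "?x \<in> measurable M ?X"
    using eps xi unfolding indep_vars_def2 by (blast intro: measurable_restrict)+

  have meas: "(\<lambda>(e, x). loss D l \<delta> \<mu> T e x) \<in> borel_measurable (?E \<Otimes>\<^sub>M ?X)"
  proof -
    have fst_i: "(\<lambda>z. fst z i) \<in> borel_measurable (?E \<Otimes>\<^sub>M ?X)" if "i \<in> {1..D}" for i
      using that by (intro measurable_compose[OF measurable_fst measurable_component_singleton])
    have fixed: "(\<lambda>z. loss D l \<delta> \<mu> (\<lambda>_. t) (fst z) (snd z)) \<in> borel_measurable (?E \<Otimes>\<^sub>M ?X)"
      if "t \<in> A" for t
    proof -
      have "t \<in> {0..real D}" using that A by blast
      then have "(\<lambda>z. snd z t) \<in> measurable (?E \<Otimes>\<^sub>M ?X) (count_space UNIV)"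
        by (intro measurable_compose[OF measurable_snd measurable_component_singleton])
      then have snd_t: "(\<lambda>z. of_bool (snd z t) :: real) \<in> borel_measurable (?E \<Otimes>\<^sub>M ?X)"
        by (rule measurable_compose) simp
      show ?thesis
        unfolding loss_def Let_def L2_set_def estimator_def observation_def
        by (intro borel_measurable_power measurable_compose[OF _ borel_measurable_sqrt] borel_measurable_sum
            borel_measurable_diff borel_measurable_times borel_measurable_add
            borel_measurable_const fst_i snd_t)
    qed
    have "(\<lambda>z. \<lambda>i\<in>{1..D}. observation l \<delta> \<mu> (fst z) i) \<in> measurable (?E \<Otimes>\<^sub>M ?X) ?E"
      unfolding observation_def
      by (intro measurable_restrict borel_measurable_add borel_measurable_times
          borel_measurable_const fst_i)
    from measurable_compose[OF this T]
    have "(\<lambda>z. T (observation l \<delta> \<mu> (fst z))) \<in> measurable (?E \<Otimes>\<^sub>M ?X) (count_space A)"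
      by (simp only: T_restrict)
    from measurable_compose_countable'[OF fixed this A(1)]
    show ?thesis unfolding loss_def Let_def case_prod_beta .
  qed
  have restr: "loss D l \<delta> \<mu> T (?e \<omega>) (?x \<omega>) = loss D l \<delta> \<mu> T (\<lambda>i::nat. \<epsilon> i \<omega>) (\<lambda>t::real. \<xi> t \<omega>)" for \<omega>
  proof -
    let ?Y = "observation l \<delta> \<mu> (\<lambda>i. \<epsilon> i \<omega>)" and ?Y' = "observation l \<delta> \<mu> (?e \<omega>)"
    have "restrict ?Y {1..D} = restrict ?Y' {1..D}"
      by (intro restrict_ext) (simp add: observation_def)
    then have TY: "T ?Y' = T ?Y"
      using T_restrict[of ?Y] T_restrict[of ?Y'] by (simp only:)
    have "restrict ?Y {1..D} \<in> space ?E" by (simp add: space_PiM)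
    then have "T ?Y \<in> {0..real D}"
      using measurable_space[OF T, of "restrict ?Y {1..D}"] A(2)
      unfolding T_restrict space_count_space by blast
    then show ?thesis
      unfolding loss_def Let_def TY
      by (intro arg_cong[where f = "\<lambda>r. r\<^sup>2"] L2_set_cong refl)
        (simp add: estimator_def observation_def)
  qed
  have "risk D l \<delta> \<mu> T = (\<integral>\<omega>. loss D l \<delta> \<mu> T (?e \<omega>) (?x \<omega>) \<partial>M)"
    unfolding risk_def law[symmetric]
    using integral_distr[OF measurable_Pair[OF rv] meas] by simp
  then show ?thesis by (simp only: restr)
qed

end

theory Submission
  imports Defs
begin

text \<open>
  Rescaling the data by \<open>\<delta>\<close> reduces everything to \<open>\<delta> = 1\<close>. With \<open>a\<^sub>i = \<lambda>\<^sub>i powr (2 * \<alpha>)\<close>,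
  \<open>A\<^sub>n = a\<^sub>1 + \<dots> + a\<^sub>n\<close>, \<open>\<beta> = 1 - 2 * \<alpha> * p\<close>, \<open>q = 2 * p + 1\<close>, \<open>S = s\<^sub>D\<close> and
  \<open>K = S powr (1 / \<beta>)\<close>, write \<open>R\<^sub>n\<close> for the residual, \<open>B\<^sub>n\<close> for the sum of \<open>\<mu>\<^sub>i\<^sup>2\<close> over \<open>i > n\<close> and
  \<open>V\<^sub>n\<close> for the sum of \<open>\<lambda>\<^sub>i\<^sup>-\<^sup>2\<close> over \<open>i \<le> n\<close>. The loss at the stopping time \<open>\<tau>\<close> is the random variance part,
  the sum of \<open>\<lambda>\<^sub>i\<^sup>-\<^sup>2 * \<epsilon>\<^sub>i\<^sup>2\<close> over \<open>i \<le> \<tau>\<close>, plus the bias \<open>B\<^sub>\<tau>\<close>. It is compared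
  with \<open>B\<^sub>k + V\<^sub>k\<close> for an arbitrary integer \<open>k\<close>; the claim
  (\<open>stopped_risk_rate\<close>) is that the stopped risk is at most a constant times
  \<open>B\<^sub>k + V\<^sub>k + K powr q\<close>.

  The only probabilistic input is the Laplace transform of \<open>R\<^sub>n\<close>, a product of
  one-dimensional Gaussian integrals, used at parameters of size at most \<open>1 / (4 * S)\<close> and with both
  signs (\<open>residual_exponential_moment\<close>). It is inserted into two pathwise inequalities, from which
  \<open>\<tau>\<close> has been eliminated before expectations are taken.

  Stopping too early costs bias (\<open>stopped_bias_le\<close>). If \<open>\<tau> < k\<close>, then the part
  of the residual between \<open>\<tau>\<close> and \<open>k\<close> is at most \<open>\<kappa> - R\<^sub>k\<close>, and this random variable
  does not depend on \<open>\<tau>\<close>; the expectation of its positive part is at most of order \<open>S + A\<^sub>k\<close>. Undoing the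
  weights multiplies it by at most \<open>\<lambda>\<^sub>k powr (- (2 + 2 * \<alpha>))\<close>, which gives at most a constant times
  \<open>(max k K) powr q\<close>. Passing from the observations to the signal costs a further multiple of \<open>V\<^sub>k\<close>.

  Stopping too late costs variance (\<open>stopped_variance_le\<close>). The index \<open>i\<close> contributes only if
  \<open>R\<^sub>n > \<kappa>\<close> for \<open>n = i - 1\<close>. Once \<open>n powr q\<close> exceeds a multiple of \<open>k powr q + K powr q + B\<^sub>k\<close>,
  the signal left in \<open>R\<^sub>n\<close> and the calibration error of \<open>\<kappa>\<close> are both dominated by
  \<open>A\<^sub>n\<close>, and a Chernoff bound makes that event exponentially unlikely in \<open>(n / K) powr \<beta>\<close>. The
  indices below the threshold cost a multiple of \<open>k powr q + K powr q + B\<^sub>k\<close> and the tail sums to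
  \<open>K powr q\<close>.

  For the oracle side, the risk at a deterministic \<open>t\<close> is the linear interpolation of
  \<open>B\<^sub>n + V\<^sub>n\<close> between \<open>n = \<lfloor>t\<rfloor>\<close> and \<open>n = \<lceil>t\<rceil>\<close> (\<open>risk_fixed_index_interpolates\<close>). So one of
  these two integers is a \<open>k\<close> whose \<open>B\<^sub>k + V\<^sub>k\<close> is at most the oracle risk, which is the first claim,
  and convexity of \<open>x powr q\<close> bounds
  \<open>t powr q\<close> by a multiple of the risk (\<open>power_index_le_risk\<close>), which for \<open>t \<ge> c * K\<close> absorbs the
  remainder \<open>K powr q\<close> and gives the second claim.
\<close>

section \<open>Gaussian integrals\<close>

abbreviation gauss :: "real measure" where
  "gauss \<equiv> density lborel std_normal_density"

abbreviation gauss_vec :: "nat \<Rightarrow> (nat \<Rightarrow> real) measure" where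
  "gauss_vec D \<equiv> \<Pi>\<^sub>M i\<in>{1..D}. gauss"

abbreviation coins :: "nat \<Rightarrow> (real \<Rightarrow> bool) measure" where
  "coins D \<equiv> \<Pi>\<^sub>M t\<in>{0..real D}. measure_pmf (bernoulli_pmf (t - of_int \<lfloor>t\<rfloor>))"

lemma prob_space_gauss: "prob_space gauss"
  by (rule prob_space_normal_density) simp

lemma gauss_even_moment:
  "integrable gauss (\<lambda>x. x ^ (2 * k))" "integral\<^sup>L gauss (\<lambda>x. x ^ (2 * k)) = fact (2 * k) / (2 ^ k * fact k)"
  using std_normal_moment_even[of k]
  by (auto simp: integrable_density integral_density has_bochner_integral_iff normal_density_nonneg)

text \<open>
  Completing the square identifies the integrand with a multiple of another normal density, with
  variance \<open>1 / (1 - 2 * s)\<close>. The logarithm of the resulting factor is expanded to second order. For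
  negative \<open>s\<close> a shift \<open>b\<close> only decreases the integral, hence the factor \<open>max 0 s\<close>.
\<close>

lemma gauss_exp_square:
  fixes s b :: real
  assumes s: "\<bar>s\<bar> \<le> 1/4"
  shows "integrable gauss (\<lambda>x. exp (s * (b + x)\<^sup>2))"
    and "integral\<^sup>L gauss (\<lambda>x. exp (s * (b + x)\<^sup>2)) \<le> exp (s + 4 * s\<^sup>2 + 2 * max 0 s * b\<^sup>2)"
proof -
  define r where "r = 1 - 2 * s"
  define \<sigma> where "\<sigma> = 1 / sqrt r"
  define m where "m = 2 * s * b / r"
  have r: "r \<ge> 1/2" using s by (simp add: r_def abs_le_iff)
  then have r0: "r > 0" by simp
  have \<sigma>2: "\<sigma>\<^sup>2 = 1 / r" using r0 by (simp add: \<sigma>_def power_divide)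
  have \<sigma>0: "\<sigma> > 0" using r0 by (simp add: \<sigma>_def)
  have eq: "std_normal_density x * exp (s * (b + x)\<^sup>2) = \<sigma> * exp (s * b\<^sup>2 / r) * normal_density m \<sigma> x" for x
  proof -
    (* both sides are multiplied by 2 * r to make the identity polynomial *)
    have "- x\<^sup>2 / 2 + s * (b + x)\<^sup>2 = s * b\<^sup>2 / r - (x - m)\<^sup>2 / (2 * \<sigma>\<^sup>2)"
    proof -
      have "(x - m)\<^sup>2 / (2 * \<sigma>\<^sup>2) = (r * x - 2 * s * b)\<^sup>2 / (2 * r)"
        using r0 unfolding \<sigma>2 m_def by (simp add: field_simps power2_eq_square)
      moreover have "r * (- x\<^sup>2 + 2 * s * (b + x)\<^sup>2) = 2 * s * b\<^sup>2 - (r * x - 2 * s * b)\<^sup>2"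
        unfolding r_def by algebra
      ultimately show ?thesis using r0 by (simp add: field_simps)
    qed
    then have "exp (- x\<^sup>2 / 2) * exp (s * (b + x)\<^sup>2) = exp (s * b\<^sup>2 / r) * exp (- (x - m)\<^sup>2 / (2 * \<sigma>\<^sup>2))"
      by (simp add: exp_add[symmetric])
    moreover have "sqrt (2 * pi * \<sigma>\<^sup>2) = \<sigma> * sqrt (2 * pi)"
      using \<sigma>0 by (simp add: real_sqrt_mult)
    ultimately show ?thesis
      using \<sigma>0 unfolding normal_density_def by (simp add: field_simps)
  qed
  show "integrable gauss (\<lambda>x. exp (s * (b + x)\<^sup>2))"
    using \<sigma>0 by (simp add: integrable_density normal_density_nonneg eq)
  have "integral\<^sup>L gauss (\<lambda>x. exp (s * (b + x)\<^sup>2)) = \<sigma> * exp (s * b\<^sup>2 / r)"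
    using \<sigma>0 by (simp add: integral_density normal_density_nonneg eq)
  also have "\<dots> = exp (- ln r / 2 + s * b\<^sup>2 / r)"
  proof -
    have "\<sigma> = exp (- ln r / 2)"
      using r0 by (simp add: \<sigma>_def ln_sqrt[symmetric] exp_minus inverse_eq_divide)
    then show ?thesis by (simp only: exp_add)
  qed
  also have "\<dots> \<le> exp (s + 4 * s\<^sup>2 + 2 * max 0 s * b\<^sup>2)"
  proof -
    have "\<bar>ln (1 + - 2 * s) - (- 2 * s)\<bar> \<le> 2 * (- 2 * s)\<^sup>2"
      using s by (intro abs_ln_one_plus_x_minus_x_bound) (simp add: abs_mult)
    then have 1: "- ln r / 2 \<le> s + 4 * s\<^sup>2" by (simp add: r_def abs_le_iff field_simps)
    have "s / r \<le> 2 * max 0 s"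
    proof (cases "s \<ge> 0")
      case True
      have "s * 1 \<le> s * (2 * r)" using True r by (intro mult_left_mono) auto
      then show ?thesis using True r0 by (simp add: field_simps)
    next
      case False then show ?thesis using r0 by (simp add: divide_nonpos_pos)
    qed
    then have "s / r * b\<^sup>2 \<le> 2 * max 0 s * b\<^sup>2" by (rule mult_right_mono) simp
    with 1 show ?thesis by simp
  qed
  finally show "integral\<^sup>L gauss (\<lambda>x. exp (s * (b + x)\<^sup>2)) \<le> exp (s + 4 * s\<^sup>2 + 2 * max 0 s * b\<^sup>2)" .
qed

lemma prob_space_gauss_vec: "prob_space (gauss_vec D)"
  by (intro prob_space_PiM prob_space_gauss)

lemma gauss_vec_coordinate:
  fixes f :: "real \<Rightarrow> real"
  assumes "i \<in> {1..D}" and f: "integrable gauss f"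
  shows "integrable (gauss_vec D) (\<lambda>e. f (e i))" "(\<integral>e. f (e i) \<partial>gauss_vec D) = integral\<^sup>L gauss f"
proof -
  have d: "distr (gauss_vec D) gauss (\<lambda>e. e i) = gauss"
    using assms(1) by (intro distr_PiM_component prob_space_gauss)
  have m: "(\<lambda>e. e i) \<in> measurable (gauss_vec D) gauss"
    using assms(1) by (rule measurable_component_singleton)
  have fm: "f \<in> borel_measurable gauss" using f by auto
  show "integrable (gauss_vec D) (\<lambda>e. f (e i))"
    using integrable_distr_eq[OF m fm] f d by simp
  show "(\<integral>e. f (e i) \<partial>gauss_vec D) = integral\<^sup>L gauss f"
    using integral_distr[OF m fm] d by simp
qed

lemma gauss_vec_moments:
  assumes "i \<in> {1..D}"
  shows "integrable (gauss_vec D) (\<lambda>e. (e i)\<^sup>2)" "(\<integral>e. (e i)\<^sup>2 \<partial>gauss_vec D) = 1"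
    "integrable (gauss_vec D) (\<lambda>e. (e i)^4)" "(\<integral>e. (e i)^4 \<partial>gauss_vec D) = 3"
  using gauss_vec_coordinate[OF assms gauss_even_moment(1)[of 1]]
    gauss_vec_coordinate[OF assms gauss_even_moment(1)[of 2]]
    gauss_even_moment(2)[of 1] gauss_even_moment(2)[of 2]
  by (simp_all add: fact_numeral)

text \<open>
  By independence the one-dimensional bounds multiply. The first two terms of the exponent are the
  mean and twice the variance of \<open>s\<close> times the weighted sum of squared noise, the last one accounts
  for the shifts \<open>b\<close>.
\<close>

lemma gauss_vec_exp_quadratic:
  fixes w b :: "nat \<Rightarrow> real" and s :: real
  assumes w: "\<And>i. i \<in> {n+1..D} \<Longrightarrow> 0 \<le> w i \<and> \<bar>s\<bar> * w i \<le> 1/4"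
  shows "integrable (gauss_vec D) (\<lambda>e. exp (s * (\<Sum>i=n+1..D. w i * (b i + e i)\<^sup>2)))"
    and "(\<integral>e. exp (s * (\<Sum>i=n+1..D. w i * (b i + e i)\<^sup>2)) \<partial>gauss_vec D)
       \<le> exp (s * (\<Sum>i=n+1..D. w i) + 4 * s\<^sup>2 * (\<Sum>i=n+1..D. (w i)\<^sup>2)
              + 2 * max 0 s * (\<Sum>i=n+1..D. w i * (b i)\<^sup>2))"
proof -
  interpret product_sigma_finite "\<lambda>_::nat. gauss"
    by (intro product_sigma_finite.intro) (simp add: prob_space_gauss prob_space_imp_sigma_finite)
  (* padding with zero weights turns the exponential into a product over all coordinates *)
  define v where "v i = (if i \<in> {n+1..D} then w i else 0)" for i
  have v: "\<bar>s * v i\<bar> \<le> 1/4" "v i \<ge> 0" for i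
    using w[of i] by (auto simp: v_def abs_mult)
  have sumv: "(\<Sum>i=n+1..D. f i * w i) = (\<Sum>i=1..D. f i * v i)" for f :: "nat \<Rightarrow> real"
    unfolding v_def by (rule sum.mono_neutral_cong_left) auto
  have e: "exp (s * (\<Sum>i=n+1..D. w i * (b i + e i)\<^sup>2)) = (\<Prod>i\<in>{1..D}. exp (s * v i * (b i + e i)\<^sup>2))" for e
    using sumv[of "\<lambda>i. (b i + e i)\<^sup>2"]
    by (simp add: exp_sum[symmetric] sum_distrib_left mult_ac)
  show "integrable (gauss_vec D) (\<lambda>e. exp (s * (\<Sum>i=n+1..D. w i * (b i + e i)\<^sup>2)))"
    unfolding e by (intro product_integrable_prod gauss_exp_square v) auto
  have "(\<integral>e. exp (s * (\<Sum>i=n+1..D. w i * (b i + e i)\<^sup>2)) \<partial>gauss_vec D)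
      = (\<Prod>i\<in>{1..D}. integral\<^sup>L gauss (\<lambda>x. exp (s * v i * (b i + x)\<^sup>2)))"
    unfolding e by (intro product_integral_prod gauss_exp_square v) auto
  also have "\<dots> \<le> (\<Prod>i\<in>{1..D}. exp (s * v i + 4 * (s * v i)\<^sup>2 + 2 * max 0 (s * v i) * (b i)\<^sup>2))"
    by (intro prod_mono conjI gauss_exp_square v integral_nonneg_AE) auto
  also have "\<dots> = exp (s * (\<Sum>i=1..D. v i) + 4 * s\<^sup>2 * (\<Sum>i=1..D. (v i)\<^sup>2)
              + 2 * max 0 s * (\<Sum>i=1..D. v i * (b i)\<^sup>2))"
  proof -
    have "max 0 (s * v i) = max 0 s * v i" for i
      using v(2)[of i] by (simp add: max_mult_distrib_right)
    then show ?thesis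
      by (simp add: exp_sum[symmetric] sum.distrib sum_distrib_left power_mult_distrib mult_ac)
  qed
  also have "(\<Sum>i=1..D. v i) = (\<Sum>i=n+1..D. w i)" using sumv[of "\<lambda>_. 1"] by simp
  also have "(\<Sum>i=1..D. (v i)\<^sup>2) = (\<Sum>i=n+1..D. (w i)\<^sup>2)"
    unfolding v_def by (rule sum.mono_neutral_cong_right) auto
  also have "(\<Sum>i=1..D. v i * (b i)\<^sup>2) = (\<Sum>i=n+1..D. w i * (b i)\<^sup>2)"
    using sumv[of "\<lambda>i. (b i)\<^sup>2"] by (simp add: mult_ac)
  finally show "(\<integral>e. exp (s * (\<Sum>i=n+1..D. w i * (b i + e i)\<^sup>2)) \<partial>gauss_vec D)
       \<le> exp (s * (\<Sum>i=n+1..D. w i) + 4 * s\<^sup>2 * (\<Sum>i=n+1..D. (w i)\<^sup>2)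
              + 2 * max 0 s * (\<Sum>i=n+1..D. w i * (b i)\<^sup>2))" .
qed

section \<open>The risk as an integral over noise and coins\<close>

lemma prob_space_coins: "prob_space (coins D)"
  by (intro prob_space_PiM measure_pmf.prob_space_axioms)

lemma coin_coordinate:
  assumes t: "t \<in> {0..real D}"
  shows "(\<lambda>x. of_bool (x t) :: real) \<in> borel_measurable (coins D)"
    and "(\<integral>x. of_bool (x t) \<partial>coins D) = t - of_int \<lfloor>t\<rfloor>"
    and "AE x in coins D. x t \<longrightarrow> t \<noteq> of_int \<lfloor>t\<rfloor>"
proof -
  let ?B = "\<lambda>t. measure_pmf (bernoulli_pmf (t - of_int \<lfloor>t\<rfloor>))"
  have q: "0 \<le> t - of_int \<lfloor>t\<rfloor>" "t - of_int \<lfloor>t\<rfloor> \<le> 1" by linarith+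
  have d: "distr (coins D) (?B t) (\<lambda>x. x t) = ?B t"
    using t by (intro distr_PiM_component measure_pmf.prob_space_axioms)
  have m: "(\<lambda>x. x t) \<in> measurable (coins D) (?B t)"
    using t by (rule measurable_component_singleton)
  then show "(\<lambda>x. of_bool (x t) :: real) \<in> borel_measurable (coins D)"
    by (rule measurable_compose) simp
  have "(\<integral>x. of_bool (x t) \<partial>coins D) = (\<integral>b. (of_bool b :: real) \<partial>distr (coins D) (?B t) (\<lambda>x. x t))"
    by (subst integral_distr[OF m]) simp_all
  then show "(\<integral>x. of_bool (x t) \<partial>coins D) = t - of_int \<lfloor>t\<rfloor>"
    unfolding d using q by simp
  show "AE x in coins D. x t \<longrightarrow> t \<noteq> of_int \<lfloor>t\<rfloor>"
  proof (rule AE_PiM_component[OF _ t])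
    show "AE b in ?B t. b \<longrightarrow> t \<noteq> of_int \<lfloor>t\<rfloor>"
      using q unfolding AE_measure_pmf_iff by (auto simp: set_pmf_iff)
  qed (rule measure_pmf.prob_space_axioms)
qed

lemma AE_noise_snd:
  assumes "AE x in coins D. P x"
  shows "AE z in noise_law D. P (snd z)"
proof -
  interpret P: prob_space "gauss_vec D" by (rule prob_space_gauss_vec)
  interpret Q: prob_space "coins D" by (rule prob_space_coins)
  interpret pair_sigma_finite "coins D" "gauss_vec D" ..
  have "distr (noise_law D) (coins D) snd = coins D"
  proof (rule measure_eqI)
    fix A assume "A \<in> sets (distr (noise_law D) (coins D) snd)"
    then have A: "A \<in> sets (coins D)" by simp
    have "snd -` A \<inter> space (noise_law D) = space (gauss_vec D) \<times> A"
      using sets.sets_into_space[OF A] by (auto simp: noise_law_def space_pair_measure)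
    then show "emeasure (distr (noise_law D) (coins D) snd) A = emeasure (coins D) A"
      using A P.emeasure_space_1
      by (simp add: emeasure_distr noise_law_def Q.emeasure_pair_measure_Times del: One_nat_def)
  qed simp
  moreover have "snd \<in> measurable (noise_law D) (coins D)" by (simp add: noise_law_def)
  ultimately show ?thesis using assms by (metis AE_distrD)
qed

lemma noise_product:
  fixes u :: "(nat \<Rightarrow> real) \<Rightarrow> real" and v :: "(real \<Rightarrow> bool) \<Rightarrow> real"
  assumes u: "integrable (gauss_vec D) u" and v: "v \<in> borel_measurable (coins D)" "\<And>x. \<bar>v x\<bar> \<le> 1"
  shows "integrable (noise_law D) (\<lambda>z. u (fst z) * v (snd z))"
    and "(\<integral>z. u (fst z) * v (snd z) \<partial>noise_law D) = integral\<^sup>L (gauss_vec D) u * integral\<^sup>L (coins D) v"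
proof -
  interpret P: prob_space "gauss_vec D" by (rule prob_space_gauss_vec)
  interpret Q: prob_space "coins D" by (rule prob_space_coins)
  interpret pair_sigma_finite "gauss_vec D" "coins D" ..
  have um: "u \<in> borel_measurable (gauss_vec D)" using u by auto
  have "integrable (distr (noise_law D) (gauss_vec D) fst) u"
    using u by (simp add: noise_law_def Q.distr_pair_fst)
  then have uf: "integrable (noise_law D) (\<lambda>z. u (fst z))"
    by (subst (asm) integrable_distr_eq) (use um in \<open>auto simp: noise_law_def\<close>)
  show int: "integrable (noise_law D) (\<lambda>z. u (fst z) * v (snd z))"
  proof (rule Bochner_Integration.integrable_bound[OF uf])
    show "(\<lambda>z. u (fst z) * v (snd z)) \<in> borel_measurable (noise_law D)"
      unfolding noise_law_def using um v(1)
      by (intro borel_measurable_times measurable_compose[OF measurable_fst] measurable_compose[OF measurable_snd])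
    show "AE z in noise_law D. norm (u (fst z) * v (snd z)) \<le> norm (u (fst z))"
      using mult_left_le[OF v(2) abs_ge_zero] by (auto simp: abs_mult)
  qed
  have "(\<integral>z. u (fst z) * v (snd z) \<partial>noise_law D) = (\<integral>e. \<integral>x. u e * v x \<partial>coins D \<partial>gauss_vec D)"
    using integral_fst'[OF int[unfolded noise_law_def]] by (simp add: noise_law_def)
  also have "\<dots> = integral\<^sup>L (gauss_vec D) u * integral\<^sup>L (coins D) v" by simp
  finally show "(\<integral>z. u (fst z) * v (snd z) \<partial>noise_law D) = integral\<^sup>L (gauss_vec D) u * integral\<^sup>L (coins D) v" .
qed

lemma loss_eq_sum:
  "loss D l \<delta> \<mu> T e x =
     (\<Sum>i=1..D. (estimator l (observation l \<delta> \<mu> e) x (T (observation l \<delta> \<mu> e)) i - \<mu> i)\<^sup>2)"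
  by (simp add: loss_def Let_def L2_set_def sum_nonneg)

text \<open>
  The coin decides whether coordinate \<open>\<lceil>t\<rceil>\<close> is estimated, at the cost of its variance, or dropped, at
  the cost of its bias; since it is independent of the noise, both costs enter with its probabilities.
\<close>

lemma risk_fixed_index:
  assumes t: "t \<in> {0..real D}" and l: "\<And>i. i \<in> {1..D} \<Longrightarrow> l i > 0"
  shows "risk D l 1 \<mu> (\<lambda>_. t) =
    (\<Sum>i=1..D. (of_bool (int i \<le> \<lfloor>t\<rfloor>) + (t - of_int \<lfloor>t\<rfloor>) * of_bool (int i = \<lceil>t\<rceil>)) * inverse ((l i)\<^sup>2)
      + (1 - (of_bool (int i \<le> \<lfloor>t\<rfloor>) + (t - of_int \<lfloor>t\<rfloor>) * of_bool (int i = \<lceil>t\<rceil>))) * (\<mu> i)\<^sup>2)"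
proof -
  interpret P: prob_space "gauss_vec D" by (rule prob_space_gauss_vec)
  interpret Q: prob_space "coins D" by (rule prob_space_coins)
  (* the conjunct excludes a coin of success probability 0 from showing heads, so that
     c takes only the values 0 and 1 *)
  define c where "c x i = (of_bool (int i \<le> \<lfloor>t\<rfloor>) + of_bool (x t \<and> t \<noteq> of_int \<lfloor>t\<rfloor>) * of_bool (int i = \<lceil>t\<rceil>) :: real)"
    for x :: "real \<Rightarrow> bool" and i
  have c01: "c x i = 0 \<or> c x i = 1" for x i
  proof -
    have "t \<noteq> of_int \<lfloor>t\<rfloor> \<Longrightarrow> \<lfloor>t\<rfloor> < \<lceil>t\<rceil>" by linarith
    then show ?thesis by (auto simp: c_def)
  qed
  have c_meas: "(\<lambda>x. c x i) \<in> borel_measurable (coins D)" for i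
  proof -
    have "(\<lambda>x. of_bool (x t \<and> t \<noteq> of_int \<lfloor>t\<rfloor>) :: real) \<in> borel_measurable (coins D)"
      using coin_coordinate(1)[OF t] by (cases "t = of_int \<lfloor>t\<rfloor>") simp_all
    then show ?thesis unfolding c_def by (intro borel_measurable_add borel_measurable_times) auto
  qed
  have c_bound: "\<bar>c x i\<bar> \<le> 1" "\<bar>1 - c x i\<bar> \<le> 1" for x i using c01[of x i] by auto
  have c_int: "integral\<^sup>L (coins D) (\<lambda>x. c x i) = of_bool (int i \<le> \<lfloor>t\<rfloor>) + (t - of_int \<lfloor>t\<rfloor>) * of_bool (int i = \<lceil>t\<rceil>)" for i
  proof -
    have i: "integrable (coins D) (\<lambda>x. of_bool (x t) :: real)"
      by (rule Q.integrable_const_bound[where B = 1]) (use coin_coordinate(1)[OF t] in auto)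
    have "integral\<^sup>L (coins D) (\<lambda>x. c x i) =
        integral\<^sup>L (coins D) (\<lambda>x. of_bool (int i \<le> \<lfloor>t\<rfloor>) + of_bool (x t) * of_bool (int i = \<lceil>t\<rceil>))"
    proof (rule integral_cong_AE[OF c_meas])
      show "(\<lambda>x. of_bool (int i \<le> \<lfloor>t\<rfloor>) + of_bool (x t) * of_bool (int i = \<lceil>t\<rceil>) :: real) \<in> borel_measurable (coins D)"
        by (intro borel_measurable_add borel_measurable_times borel_measurable_const coin_coordinate(1)[OF t])
      show "AE x in coins D. c x i = of_bool (int i \<le> \<lfloor>t\<rfloor>) + of_bool (x t) * of_bool (int i = \<lceil>t\<rceil>)"
        by (rule AE_mp[OF coin_coordinate(3)[OF t]], rule AE_I2) (auto simp: c_def)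
    qed
    also have "\<dots> = of_bool (int i \<le> \<lfloor>t\<rfloor>) + (t - of_int \<lfloor>t\<rfloor>) * of_bool (int i = \<lceil>t\<rceil>)"
      using i coin_coordinate(2)[OF t] Q.prob_space by simp
    finally show ?thesis .
  qed
  have c_int': "integral\<^sup>L (coins D) (\<lambda>x. 1 - c x i) = 1 - integral\<^sup>L (coins D) (\<lambda>x. c x i)" for i
    using Q.prob_space
    by (subst Bochner_Integration.integral_diff)
      (auto intro!: Q.integrable_const_bound[where B = 1] c_meas c_bound)
  define g where "g i z = inverse ((l i)\<^sup>2) * (fst z i)\<^sup>2 * c (snd z) i + (\<mu> i)\<^sup>2 * (1 - c (snd z) i)"
    for i and z :: "(nat \<Rightarrow> real) \<times> (real \<Rightarrow> bool)"
  have parts: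
    "integrable (noise_law D) (\<lambda>z. inverse ((l i)\<^sup>2) * (fst z i)\<^sup>2 * c (snd z) i)"
    "(\<integral>z. inverse ((l i)\<^sup>2) * (fst z i)\<^sup>2 * c (snd z) i \<partial>noise_law D)
       = inverse ((l i)\<^sup>2) * integral\<^sup>L (coins D) (\<lambda>x. c x i)"
    "integrable (noise_law D) (\<lambda>z. (\<mu> i)\<^sup>2 * (1 - c (snd z) i))"
    "(\<integral>z. (\<mu> i)\<^sup>2 * (1 - c (snd z) i) \<partial>noise_law D) = (\<mu> i)\<^sup>2 * (1 - integral\<^sup>L (coins D) (\<lambda>x. c x i))"
    if i: "i \<in> {1..D}" for i
  proof -
    have u: "integrable (gauss_vec D) (\<lambda>e. inverse ((l i)\<^sup>2) * (e i)\<^sup>2)"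
      using gauss_vec_moments(1)[OF i] by simp
    show "integrable (noise_law D) (\<lambda>z. inverse ((l i)\<^sup>2) * (fst z i)\<^sup>2 * c (snd z) i)"
      by (rule noise_product(1)[OF u c_meas c_bound(1)])
    show "(\<integral>z. inverse ((l i)\<^sup>2) * (fst z i)\<^sup>2 * c (snd z) i \<partial>noise_law D)
       = inverse ((l i)\<^sup>2) * integral\<^sup>L (coins D) (\<lambda>x. c x i)"
      using noise_product(2)[OF u c_meas c_bound(1)] gauss_vec_moments(2)[OF i] by simp
    have w: "integrable (gauss_vec D) (\<lambda>e. (\<mu> i)\<^sup>2)" by (rule P.integrable_const)
    have m: "(\<lambda>x. 1 - c x i) \<in> borel_measurable (coins D)" using c_meas by simp
    show "integrable (noise_law D) (\<lambda>z. (\<mu> i)\<^sup>2 * (1 - c (snd z) i))"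
      by (rule noise_product(1)[OF w m c_bound(2)])
    show "(\<integral>z. (\<mu> i)\<^sup>2 * (1 - c (snd z) i) \<partial>noise_law D) = (\<mu> i)\<^sup>2 * (1 - integral\<^sup>L (coins D) (\<lambda>x. c x i))"
      using noise_product(2)[OF w m c_bound(2)] P.prob_space by (simp add: c_int')
  qed
  have "risk D l 1 \<mu> (\<lambda>_. t) = (\<integral>z. (\<Sum>i=1..D. g i z) \<partial>noise_law D)"
    unfolding risk_def
  proof (rule integral_cong_AE)
    show int: "(\<lambda>z. \<Sum>i=1..D. g i z) \<in> borel_measurable (noise_law D)"
      unfolding g_def by (intro borel_measurable_sum borel_measurable_add borel_measurable_integrable parts)
    show "AE z in noise_law D. (case z of (e, x) \<Rightarrow> loss D l 1 \<mu> (\<lambda>_. t) e x) = (\<Sum>i=1..D. g i z)"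
    proof (rule AE_mp[OF AE_noise_snd[OF coin_coordinate(3)[OF t]]], rule AE_I2, rule impI)
      fix z :: "(nat \<Rightarrow> real) \<times> (real \<Rightarrow> bool)"
      assume z: "snd z t \<longrightarrow> t \<noteq> of_int \<lfloor>t\<rfloor>"
      have "(estimator l (observation l 1 \<mu> (fst z)) (snd z) t i - \<mu> i)\<^sup>2 = g i z" if i: "i \<in> {1..D}" for i
      proof -
        have "estimator l (observation l 1 \<mu> (fst z)) (snd z) t i = c (snd z) i * (\<mu> i + inverse (l i) * fst z i)"
          using z l[OF i] by (auto simp: estimator_def observation_def c_def field_simps)
        then show ?thesis
          using c01[of "snd z" i] by (auto simp: g_def power_mult_distrib power_inverse)
      qed
      then show "(case z of (e, x) \<Rightarrow> loss D l 1 \<mu> (\<lambda>_. t) e x) = (\<Sum>i=1..D. g i z)"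
        by (simp add: loss_eq_sum case_prod_beta)
    qed
    show "(\<lambda>(e, x). loss D l 1 \<mu> (\<lambda>_. t) e x) \<in> borel_measurable (noise_law D)"
    proof -
      have f: "(\<lambda>z. fst z i) \<in> borel_measurable (noise_law D)" if i: "i \<in> {1..D}" for i
      proof -
        have "(\<lambda>e. e i) \<in> borel_measurable (gauss_vec D)"
          using measurable_component_singleton[OF i, of "\<lambda>_. gauss"] by simp
        then show ?thesis unfolding noise_law_def by (rule measurable_compose[OF measurable_fst])
      qed
      have x: "(\<lambda>z. of_bool (snd z t) :: real) \<in> borel_measurable (noise_law D)"
        unfolding noise_law_def using coin_coordinate(1)[OF t] by (rule measurable_compose[OF measurable_snd])
      show ?thesis
        unfolding loss_eq_sum case_prod_beta estimator_def observation_def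
        by (intro borel_measurable_power borel_measurable_sum borel_measurable_diff
            borel_measurable_times borel_measurable_add borel_measurable_const f x)
    qed
  qed
  also have "\<dots> = (\<Sum>i=1..D. \<integral>z. g i z \<partial>noise_law D)"
    unfolding g_def by (intro Bochner_Integration.integral_sum Bochner_Integration.integrable_add parts)
  also have "\<dots> = (\<Sum>i=1..D. inverse ((l i)\<^sup>2) * integral\<^sup>L (coins D) (\<lambda>x. c x i)
      + (\<mu> i)\<^sup>2 * (1 - integral\<^sup>L (coins D) (\<lambda>x. c x i)))"
    unfolding g_def by (intro sum.cong refl) (simp only: Bochner_Integration.integral_add[OF parts(1) parts(3)] parts)
  finally show ?thesis unfolding c_int by (simp only: mult.commute)
qed

text \<open>
  For a data-dependent index only upper bounds are needed, and these follow from a pathwise bound by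
  an integrable function of the noise. The coins at the integers almost surely show tails, all at once because only
  finitely many integers occur.
\<close>

lemma risk_integer_index_le:
  fixes T :: "(nat \<Rightarrow> real) \<Rightarrow> nat" and g :: "(nat \<Rightarrow> real) \<Rightarrow> real"
  assumes T: "\<And>Y. T Y \<le> D" and l: "\<And>i. i \<in> {1..D} \<Longrightarrow> l i > 0"
    and g: "integrable (gauss_vec D) g" "\<And>e. 0 \<le> g e"
    and le: "\<And>e m. m = T (observation l 1 \<mu> e) \<Longrightarrow>
        (\<Sum>i=1..m. inverse ((l i)\<^sup>2) * (e i)\<^sup>2) + (\<Sum>i=m+1..D. (\<mu> i)\<^sup>2) \<le> g e"
  shows "risk D l 1 \<mu> (\<lambda>Y. real (T Y)) \<le> integral\<^sup>L (gauss_vec D) g"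
proof -
  interpret Q: prob_space "coins D" by (rule prob_space_coins)
  have "AE x in coins D. \<forall>m\<in>{0..D}. \<not> x (real m)"
  proof (rule AE_finite_allI)
    fix m assume m: "m \<in> {0..D}"
    show "AE x in coins D. \<not> x (real m)"
      using coin_coordinate(3)[of "real m" D] m by simp
  qed simp
  then have coins0: "AE z in noise_law D. \<forall>m\<in>{0..D}. \<not> snd z (real m)" by (rule AE_noise_snd)
  have int: "integrable (noise_law D) (\<lambda>z. g (fst z))" "(\<integral>z. g (fst z) \<partial>noise_law D) = integral\<^sup>L (gauss_vec D) g"
    using noise_product[OF g(1), of "\<lambda>_. 1"] Q.prob_space by simp_all
  have "risk D l 1 \<mu> (\<lambda>Y. real (T Y)) \<le> (\<integral>z. g (fst z) \<partial>noise_law D)"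
    unfolding risk_def
  proof (rule integral_mono_AE'[OF int(1)])
    show "AE z in noise_law D. (case z of (e, x) \<Rightarrow> loss D l 1 \<mu> (\<lambda>Y. real (T Y)) e x) \<le> g (fst z)"
    proof (rule AE_mp[OF coins0], rule AE_I2, rule impI)
      fix z :: "(nat \<Rightarrow> real) \<times> (real \<Rightarrow> bool)"
      assume z: "\<forall>m\<in>{0..D}. \<not> snd z (real m)"
      define m where "m = T (observation l 1 \<mu> (fst z))"
      have mD: "m \<le> D" using T by (simp add: m_def)
      have "(estimator l (observation l 1 \<mu> (fst z)) (snd z) (real m) i - \<mu> i)\<^sup>2
          = (if i \<le> m then inverse ((l i)\<^sup>2) * (fst z i)\<^sup>2 else (\<mu> i)\<^sup>2)" if i: "i \<in> {1..D}" for i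
        using z mD l[OF i]
        by (auto simp: estimator_def observation_def field_simps power_mult_distrib power_inverse)
      then have "loss D l 1 \<mu> (\<lambda>Y. real (T Y)) (fst z) (snd z)
          = (\<Sum>i=1..D. if i \<le> m then inverse ((l i)\<^sup>2) * (fst z i)\<^sup>2 else (\<mu> i)\<^sup>2)"
        by (simp add: loss_eq_sum m_def[symmetric])
      also have "\<dots> = (\<Sum>i=1..m. inverse ((l i)\<^sup>2) * (fst z i)\<^sup>2) + (\<Sum>i=m+1..D. (\<mu> i)\<^sup>2)"
      proof -
        have "{1..D} \<inter> {i. i \<le> m} = {1..m}" "{1..D} \<inter> - {i. i \<le> m} = {m+1..D}" using mD by auto
        then show ?thesis by (simp add: sum.If_cases)
      qed
      also have "\<dots> \<le> g (fst z)" by (rule le[OF m_def])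
      finally show "(case z of (e, x) \<Rightarrow> loss D l 1 \<mu> (\<lambda>Y. real (T Y)) e x) \<le> g (fst z)"
        by (simp add: case_prod_beta)
    qed
  qed (simp add: g(2))
  then show ?thesis using int(2) by simp
qed

section \<open>Stopping too early and too late\<close>

lemma stopping_time_crossing:
  assumes "\<kappa> > 0"
  shows "residual \<alpha> D l Y (stopping_time \<alpha> D l \<kappa> Y) \<le> \<kappa>"
    and "n < stopping_time \<alpha> D l \<kappa> Y \<Longrightarrow> residual \<alpha> D l Y n > \<kappa>"
proof -
  let ?S = "{m. m \<le> D \<and> residual \<alpha> D l Y m \<le> \<kappa>}"
  have "D \<in> ?S" using assms by (simp add: residual_def)
  then have "Inf ?S \<in> ?S" by (intro Inf_nat_def1) auto
  then show "residual \<alpha> D l Y (stopping_time \<alpha> D l \<kappa> Y) \<le> \<kappa>"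
    by (simp add: stopping_time_def)
  assume n: "n < stopping_time \<alpha> D l \<kappa> Y"
  then have "n \<notin> ?S" using cInf_lower[of n ?S] by (auto simp: stopping_time_def)
  moreover have "n \<le> D" using n stopping_time_le[OF assms, of \<alpha> D l Y] by simp
  ultimately show "residual \<alpha> D l Y n > \<kappa>" by auto
qed

text \<open>
  The bias between a premature stopping time \<open>m\<close> and \<open>k\<close> is read off from the data: the weighted
  squares of the observations between \<open>m\<close> and \<open>k\<close> sum to the difference of two residuals, of which the
  first is at most \<open>\<kappa>\<close>. Bounding the difference by an exponential removes the dependence on \<open>m\<close> and
  makes the expectation a Laplace transform; \<open>w\<close> undoes the weights. The last
  sum is the noise in those observations.
\<close>

lemma stopped_bias_le:
  fixes s :: real
  assumes \<kappa>: "\<kappa> > 0" and s: "s > 0" and k: "k \<le> D"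
    and pos: "\<And>i. i \<in> {1..D} \<Longrightarrow> 0 < l i"
    and w: "\<And>i. i \<in> {1..k} \<Longrightarrow> l i powr (- (2 + 2 * \<alpha>)) \<le> w" "w \<ge> 0"
    and Y: "Y = observation l 1 \<mu> e" and m: "m = stopping_time \<alpha> D l \<kappa> Y"
  shows "(\<Sum>i=m+1..D. (\<mu> i)\<^sup>2) \<le> (\<Sum>i=k+1..D. (\<mu> i)\<^sup>2)
      + 2 * w * (exp (s * (\<kappa> - residual \<alpha> D l Y k)) / s)
      + 2 * (\<Sum>i=1..k. inverse ((l i)\<^sup>2) * (e i)\<^sup>2)"
proof (cases "m < k")
  case False
  have "(\<Sum>i=m+1..D. (\<mu> i)\<^sup>2) \<le> (\<Sum>i=k+1..D. (\<mu> i)\<^sup>2)"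
    using False by (intro sum_mono2) auto
  moreover have "0 \<le> 2 * w * (exp (s * (\<kappa> - residual \<alpha> D l Y k)) / s)"
    using s w(2) by simp
  moreover have "0 \<le> 2 * (\<Sum>i=1..k. inverse ((l i)\<^sup>2) * (e i)\<^sup>2)"
    by (simp add: sum_nonneg)
  ultimately show ?thesis by linarith
next
  case True
  let ?a = "\<lambda>i. l i powr (2 * \<alpha>)"
  have split: "(\<Sum>i=m+1..D. f i) = (\<Sum>i=m+1..k. f i) + (\<Sum>i=k+1..D. f i)" for f :: "nat \<Rightarrow> real"
  proof -
    have "{m+1..D} = {m+1..k} \<union> {k+1..D}" using True k by auto
    then show ?thesis by (simp add: sum.union_disjoint)
  qed
  have coord: "(\<mu> i)\<^sup>2 \<le> 2 * w * (?a i * (Y i)\<^sup>2) + 2 * (inverse ((l i)\<^sup>2) * (e i)\<^sup>2)" if i: "i \<in> {m+1..k}" for i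
  proof -
    have li: "0 < l i" using i k pos[of i] by auto
    have "l i powr (- (2 + 2 * \<alpha>)) \<le> w" using i by (intro w(1)) auto
    then have "l i powr (- (2 + 2 * \<alpha>)) * (?a i * (Y i)\<^sup>2) \<le> w * (?a i * (Y i)\<^sup>2)"
      by (rule mult_right_mono) simp
    moreover have "l i powr (- (2 + 2 * \<alpha>)) * ?a i = inverse ((l i)\<^sup>2)"
      using li by (simp add: powr_add[symmetric] powr_minus powr_realpow[of "l i" 2, simplified])
    ultimately have 1: "inverse ((l i)\<^sup>2) * (Y i)\<^sup>2 \<le> w * (?a i * (Y i)\<^sup>2)"
      by (simp add: mult.assoc[symmetric])
    have "\<mu> i = inverse (l i) * Y i - inverse (l i) * e i"
      using li by (simp add: Y observation_def field_simps)
    moreover have "(x - y)\<^sup>2 \<le> 2 * x\<^sup>2 + 2 * y\<^sup>2" for x y :: real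
      using zero_le_power2[of "x + y"] by (simp add: power2_sum power2_diff)
    ultimately have "(\<mu> i)\<^sup>2 \<le> 2 * (inverse (l i) * Y i)\<^sup>2 + 2 * (inverse (l i) * e i)\<^sup>2" by metis
    with 1 show ?thesis by (simp add: power_mult_distrib power_inverse)
  qed
  have "(\<Sum>i=m+1..k. ?a i * (Y i)\<^sup>2) = residual \<alpha> D l Y m - residual \<alpha> D l Y k"
    unfolding residual_def using split[of "\<lambda>i. ?a i * (Y i)\<^sup>2"] by simp
  also have "\<dots> \<le> \<kappa> - residual \<alpha> D l Y k"
    using stopping_time_crossing(1)[OF \<kappa>, of \<alpha> D l Y] by (simp add: m)
  also have "\<dots> \<le> exp (s * (\<kappa> - residual \<alpha> D l Y k)) / s"
  proof -
    have "s * (\<kappa> - residual \<alpha> D l Y k) \<le> exp (s * (\<kappa> - residual \<alpha> D l Y k))"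
      using exp_ge_add_one_self[of "s * (\<kappa> - residual \<alpha> D l Y k)"] by linarith
    then show ?thesis using s by (simp add: pos_le_divide_eq mult.commute)
  qed
  finally have e: "(\<Sum>i=m+1..k. ?a i * (Y i)\<^sup>2) \<le> exp (s * (\<kappa> - residual \<alpha> D l Y k)) / s" .
  have "(\<Sum>i=m+1..k. (\<mu> i)\<^sup>2) \<le> (\<Sum>i=m+1..k. 2 * w * (?a i * (Y i)\<^sup>2) + 2 * (inverse ((l i)\<^sup>2) * (e i)\<^sup>2))"
    by (intro sum_mono coord)
  also have "\<dots> = 2 * w * (\<Sum>i=m+1..k. ?a i * (Y i)\<^sup>2) + 2 * (\<Sum>i=m+1..k. inverse ((l i)\<^sup>2) * (e i)\<^sup>2)"
    by (simp add: sum.distrib sum_distrib_left)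
  also have "\<dots> \<le> 2 * w * (exp (s * (\<kappa> - residual \<alpha> D l Y k)) / s)
      + 2 * (\<Sum>i=1..k. inverse ((l i)\<^sup>2) * (e i)\<^sup>2)"
    by (intro add_mono mult_left_mono e sum_mono2) (auto simp: w(2))
  finally show ?thesis unfolding split[of "\<lambda>i. (\<mu> i)\<^sup>2"] by linarith
qed

text \<open>
  An index \<open>i \<in> G\<close> counts only if the residual at \<open>i - 1\<close> is still above \<open>\<kappa>\<close>, and then the exponential
  is at least 1. The product of this exponential with the correlated \<open>\<epsilon>\<^sub>i\<^sup>2\<close> is
  separated by the arithmetic-geometric mean inequality with a free parameter \<open>\<theta> i\<close>.
\<close>

lemma stopped_variance_le:
  fixes s :: real and \<theta> :: "nat \<Rightarrow> real"
  assumes \<kappa>: "\<kappa> > 0" and s: "s > 0" and G: "G \<subseteq> {1..D}" and \<theta>: "\<And>i. \<theta> i > 0"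
    and m: "m = stopping_time \<alpha> D l \<kappa> Y"
  shows "(\<Sum>i=1..m. inverse ((l i)\<^sup>2) * (e i)\<^sup>2) \<le> (\<Sum>i\<in>{1..D}-G. inverse ((l i)\<^sup>2) * (e i)\<^sup>2)
      + (\<Sum>i\<in>G. inverse ((l i)\<^sup>2) * ((\<theta> i * (e i)^4 + exp (s * (residual \<alpha> D l Y (i - 1) - \<kappa>)) / \<theta> i) / 2))"
proof -
  have fin: "finite G" using G finite_subset by blast
  have mD: "m \<le> D" using stopping_time_le[OF \<kappa>] by (simp add: m)
  have amgm: "x \<le> (\<theta> i * x\<^sup>2 + 1 / \<theta> i) / 2" for x i
    using zero_le_power2[of "\<theta> i * x - 1"] \<theta>[of i]
    by (simp add: field_simps power2_eq_square)
  have "(\<Sum>i=1..m. inverse ((l i)\<^sup>2) * (e i)\<^sup>2)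
      = (\<Sum>i\<in>{1..m}-G. inverse ((l i)\<^sup>2) * (e i)\<^sup>2) + (\<Sum>i\<in>{1..m}\<inter>G. inverse ((l i)\<^sup>2) * (e i)\<^sup>2)"
    using sum.Int_Diff[of "{1..m}" "\<lambda>i. inverse ((l i)\<^sup>2) * (e i)\<^sup>2" G] by simp
  also have "(\<Sum>i\<in>{1..m}-G. inverse ((l i)\<^sup>2) * (e i)\<^sup>2) \<le> (\<Sum>i\<in>{1..D}-G. inverse ((l i)\<^sup>2) * (e i)\<^sup>2)"
    using mD by (intro sum_mono2) auto
  also have "(\<Sum>i\<in>{1..m}\<inter>G. inverse ((l i)\<^sup>2) * (e i)\<^sup>2)
      \<le> (\<Sum>i\<in>{1..m}\<inter>G. inverse ((l i)\<^sup>2) * ((\<theta> i * (e i)^4 + exp (s * (residual \<alpha> D l Y (i - 1) - \<kappa>)) / \<theta> i) / 2))"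
  proof (intro sum_mono mult_left_mono)
    fix i assume i: "i \<in> {1..m} \<inter> G"
    then have "residual \<alpha> D l Y (i - 1) > \<kappa>"
      by (intro stopping_time_crossing(2)[OF \<kappa>]) (auto simp: m)
    then have "1 / \<theta> i \<le> exp (s * (residual \<alpha> D l Y (i - 1) - \<kappa>)) / \<theta> i"
      using s \<theta>[of i] by (intro divide_right_mono) auto
    moreover have "(e i)\<^sup>2 \<le> (\<theta> i * (e i)^4 + 1 / \<theta> i) / 2"
      using amgm[of "(e i)\<^sup>2" i] by simp
    moreover have "a \<le> (b + c) / 2 \<Longrightarrow> c \<le> d \<Longrightarrow> a \<le> (b + d) / 2" for a b c d :: real by simp
    ultimately show "(e i)\<^sup>2 \<le> (\<theta> i * (e i)^4 + exp (s * (residual \<alpha> D l Y (i - 1) - \<kappa>)) / \<theta> i) / 2"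
      by blast
  qed simp
  also have "\<dots> \<le> (\<Sum>i\<in>G. inverse ((l i)\<^sup>2) * ((\<theta> i * (e i)^4 + exp (s * (residual \<alpha> D l Y (i - 1) - \<kappa>)) / \<theta> i) / 2))"
    using \<theta> by (intro sum_mono2 fin mult_nonneg_nonneg) (auto intro!: add_nonneg_nonneg simp: less_imp_le)
  finally show ?thesis by simp
qed

lemma s_D_properties:
  assumes pos: "\<And>i. i \<in> {1..D} \<Longrightarrow> 0 < l i" and D: "D \<ge> 1"
  shows "s_D \<alpha> D l > 0"
    and "(s_D \<alpha> D l)\<^sup>2 = 2 * (\<Sum>i=1..D. (l i powr (2 * \<alpha>))\<^sup>2)"
    and "i \<in> {1..D} \<Longrightarrow> l i powr (2 * \<alpha>) \<le> s_D \<alpha> D l"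
proof -
  have sq: "l i powr (4 * \<alpha>) = (l i powr (2 * \<alpha>))\<^sup>2" for i
    by (simp add: power2_eq_square powr_add[symmetric])
  have p: "(\<Sum>i=1..D. l i powr (4 * \<alpha>)) > 0"
    using D pos by (intro sum_pos) (force+)
  then show "s_D \<alpha> D l > 0" by (simp add: s_D_def)
  show e: "(s_D \<alpha> D l)\<^sup>2 = 2 * (\<Sum>i=1..D. (l i powr (2 * \<alpha>))\<^sup>2)"
    using p by (simp add: s_D_def sq)
  show "l i powr (2 * \<alpha>) \<le> s_D \<alpha> D l" if "i \<in> {1..D}"
  proof (rule power2_le_imp_le)
    have "(l i powr (2 * \<alpha>))\<^sup>2 \<le> (\<Sum>i=1..D. (l i powr (2 * \<alpha>))\<^sup>2)"
      using that by (intro member_le_sum) auto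
    moreover have "0 \<le> (\<Sum>i=1..D. (l i powr (2 * \<alpha>))\<^sup>2)" by (simp add: sum_nonneg)
    ultimately show "(l i powr (2 * \<alpha>))\<^sup>2 \<le> (s_D \<alpha> D l)\<^sup>2" unfolding e by linarith
    show "0 \<le> s_D \<alpha> D l" by (simp add: s_D_def sum_nonneg)
  qed
qed

text \<open>
  At parameters of size at most \<open>1 / (4 * s\<^sub>D)\<close> the second-order term of the exponent is bounded by a
  constant, because \<open>s\<^sub>D\<^sup>2\<close> is the variance of the full weighted sum of squared noise.
\<close>

lemma residual_exponential_moment:
  fixes s :: real
  assumes pos: "\<And>i. i \<in> {1..D} \<Longrightarrow> 0 < l i" and D: "D \<ge> 1" and s: "4 * \<bar>s\<bar> * s_D \<alpha> D l \<le> 1"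
  shows "integrable (gauss_vec D) (\<lambda>e. exp (s * residual \<alpha> D l (observation l 1 \<mu> e) n))"
    and "(\<integral>e. exp (s * residual \<alpha> D l (observation l 1 \<mu> e) n) \<partial>gauss_vec D)
      \<le> exp (s * (\<Sum>i=n+1..D. l i powr (2 * \<alpha>)) + 1 / 8
             + 2 * max 0 s * (\<Sum>i=n+1..D. l i powr (2 * \<alpha>) * (l i * \<mu> i)\<^sup>2))"
proof -
  note S = s_D_properties[where D = D and l = l and \<alpha> = \<alpha>, OF pos D]
  have w: "0 \<le> l i powr (2 * \<alpha>) \<and> \<bar>s\<bar> * l i powr (2 * \<alpha>) \<le> 1/4" if "i \<in> {n+1..D}" for i
  proof -
    have "\<bar>s\<bar> * l i powr (2 * \<alpha>) \<le> \<bar>s\<bar> * s_D \<alpha> D l"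
      using that S(3)[of i] by (intro mult_left_mono) auto
    then show ?thesis using s by simp
  qed
  have R: "residual \<alpha> D l (observation l 1 \<mu> e) n = (\<Sum>i=n+1..D. l i powr (2 * \<alpha>) * (l i * \<mu> i + e i)\<^sup>2)" for e
    by (simp add: residual_def observation_def)
  show "integrable (gauss_vec D) (\<lambda>e. exp (s * residual \<alpha> D l (observation l 1 \<mu> e) n))"
    unfolding R using w by (rule gauss_vec_exp_quadratic(1))
  have "(\<integral>e. exp (s * residual \<alpha> D l (observation l 1 \<mu> e) n) \<partial>gauss_vec D)
      \<le> exp (s * (\<Sum>i=n+1..D. l i powr (2 * \<alpha>)) + 4 * s\<^sup>2 * (\<Sum>i=n+1..D. (l i powr (2 * \<alpha>))\<^sup>2)
             + 2 * max 0 s * (\<Sum>i=n+1..D. l i powr (2 * \<alpha>) * (l i * \<mu> i)\<^sup>2))"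
    unfolding R using w by (rule gauss_vec_exp_quadratic(2))
  moreover have "4 * s\<^sup>2 * (\<Sum>i=n+1..D. (l i powr (2 * \<alpha>))\<^sup>2) \<le> 1 / 8"
  proof -
    have "(\<Sum>i=n+1..D. (l i powr (2 * \<alpha>))\<^sup>2) \<le> (\<Sum>i=1..D. (l i powr (2 * \<alpha>))\<^sup>2)"
      by (rule sum_mono2) auto
    then have "4 * s\<^sup>2 * (\<Sum>i=n+1..D. (l i powr (2 * \<alpha>))\<^sup>2)
        \<le> 4 * s\<^sup>2 * (\<Sum>i=1..D. (l i powr (2 * \<alpha>))\<^sup>2)" by (intro mult_left_mono) auto
    also have "\<dots> = 2 * s\<^sup>2 * (s_D \<alpha> D l)\<^sup>2" using S(2) by simp
    also have "\<dots> = (4 * \<bar>s\<bar> * s_D \<alpha> D l)\<^sup>2 / 8" by (simp add: power_mult_distrib)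
    also have "\<dots> \<le> 1 / 8"
      using s S(1) by (intro divide_right_mono power_le_one) auto
    finally show ?thesis .
  qed
  ultimately show "(\<integral>e. exp (s * residual \<alpha> D l (observation l 1 \<mu> e) n) \<partial>gauss_vec D)
      \<le> exp (s * (\<Sum>i=n+1..D. l i powr (2 * \<alpha>)) + 1 / 8
             + 2 * max 0 s * (\<Sum>i=n+1..D. l i powr (2 * \<alpha>) * (l i * \<mu> i)\<^sup>2))"
    by (elim order_trans) simp
qed

text \<open>
  Expectations of the two pathwise bounds. The parameter \<open>u\<close> of the lower tail is chosen of the order
  \<open>1 / (S + A k)\<close>, because \<open>\<kappa> - R\<^sub>k\<close> rarely exceeds the order of \<open>S + A k\<close>, and the parameter \<open>v\<close> of the upper
  tail is as large as the Laplace transform permits. For \<open>i \<in> G\<close> the signal and the calibration error use up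
  at most half of \<open>A (i - 1)\<close>, so the other half remains in the exponent.
\<close>

lemma stopped_risk_le_terms:
  assumes D: "D \<ge> 1" and \<kappa>: "\<kappa> > 0" and k: "k \<le> D" and C: "C\<^sub>\<kappa> \<ge> 0"
    and pos: "\<And>i. i \<in> {1..D} \<Longrightarrow> 0 < l i"
    and w: "\<And>i. i \<in> {1..k} \<Longrightarrow> l i powr (- (2 + 2 * \<alpha>)) \<le> w" "w \<ge> 0"
    and S_def: "S = s_D \<alpha> D l" and A_def: "\<And>n. A n = (\<Sum>i=1..n. l i powr (2 * \<alpha>))"
    and calib: "\<bar>\<kappa> - A D\<bar> \<le> C\<^sub>\<kappa> * S"
    and G: "G \<subseteq> {1..D}"
    and good: "\<And>i. i \<in> G \<Longrightarrow>
      2 * (\<Sum>j=i..D. l j powr (2 * \<alpha>) * (l j * \<mu> j)\<^sup>2) + C\<^sub>\<kappa> * S \<le> A (i - 1) / 2"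
  shows "stopped_risk \<alpha> D l 1 \<kappa> \<mu> \<le> (\<Sum>i=k+1..D. (\<mu> i)\<^sup>2)
      + 8 * exp (C\<^sub>\<kappa> + 1) * (w * (S + A k))
      + 2 * (\<Sum>i=1..k. inverse ((l i)\<^sup>2))
      + (\<Sum>i\<in>{1..D}-G. inverse ((l i)\<^sup>2))
      + (\<Sum>i\<in>G. inverse ((l i)\<^sup>2) * (2 * exp (1 / 16 - A (i - 1) / (16 * S))))"
proof -
  interpret P: prob_space "gauss_vec D" by (rule prob_space_gauss_vec)
  have S: "S > 0" using s_D_properties(1)[where D = D and l = l and \<alpha> = \<alpha>, OF pos D] by (simp add: S_def)
  have A0: "A n \<ge> 0" for n unfolding A_def by (simp add: sum_nonneg)
  have Asplit: "A D = A n + (\<Sum>i=n+1..D. l i powr (2 * \<alpha>))" if "n \<le> D" for n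
  proof -
    have "{1..D} = {1..n} \<union> {n+1..D}" using that by auto
    then show ?thesis unfolding A_def by (simp add: sum.union_disjoint)
  qed
  let ?R = "\<lambda>n e. residual \<alpha> D l (observation l 1 \<mu> e) n"
  define u where "u = 1 / (4 * (S + A k))"
  define v where "v = 1 / (4 * S)"
  (* the square root of the bound on the exponential moment balances the two summands of the
     arithmetic-geometric mean inequality *)
  define \<theta> where "\<theta> i = exp (1 / 16 - A (i - 1) / (16 * S))" for i
  have u: "u > 0" "4 * \<bar>- u\<bar> * S \<le> 1" using S A0[of k] by (auto simp: u_def field_simps)
  have v: "v > 0" "4 * \<bar>v\<bar> * S \<le> 1" using S by (auto simp: v_def)
  have fin: "finite G" using G finite_subset by blast
  have shift: "exp (s * (\<kappa> - ?R n e)) = exp (s * \<kappa>) * exp (- s * ?R n e)"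
    "exp (s * (?R n e - \<kappa>)) = exp (- s * \<kappa>) * exp (s * ?R n e)" for s n e
    by (simp_all add: exp_add[symmetric] algebra_simps)

  have lower_int: "integrable (gauss_vec D) (\<lambda>e. exp (u * (\<kappa> - ?R k e)))"
    using residual_exponential_moment(1)[where D = D and l = l and \<alpha> = \<alpha>, OF pos D u(2)[unfolded S_def]] unfolding shift by (intro integrable_mult_right) simp
  have lower: "(\<integral>e. exp (u * (\<kappa> - ?R k e)) \<partial>gauss_vec D) \<le> exp (C\<^sub>\<kappa> + 1)"
  proof -
    have "(\<integral>e. exp (u * (\<kappa> - ?R k e)) \<partial>gauss_vec D)
        = exp (u * \<kappa>) * (\<integral>e. exp (- u * ?R k e) \<partial>gauss_vec D)"
      unfolding shift by simp
    also have "\<dots> \<le> exp (u * \<kappa>) * exp (- u * (\<Sum>i=k+1..D. l i powr (2 * \<alpha>)) + 1 / 8)"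
      using residual_exponential_moment(2)[where D = D and l = l and \<alpha> = \<alpha>, OF pos D u(2)[unfolded S_def], where \<mu> = \<mu> and n = k] u(1)
      by (intro mult_left_mono) (simp_all add: max_def)
    also have "\<dots> = exp (u * (\<kappa> - A D + A k) + 1 / 8)"
      using Asplit[OF k] by (simp add: exp_add[symmetric] algebra_simps)
    also have "\<dots> \<le> exp (C\<^sub>\<kappa> + 1)"
    proof -
      have "\<kappa> - A D + A k \<le> (C\<^sub>\<kappa> + 1) * (S + A k)"
        using calib mult_nonneg_nonneg[OF C A0[of k]] S by (simp add: abs_le_iff algebra_simps)
      then have "u * (\<kappa> - A D + A k) \<le> u * ((C\<^sub>\<kappa> + 1) * (S + A k))"
        using u(1) by (intro mult_left_mono) auto
      also have "\<dots> = (C\<^sub>\<kappa> + 1) / 4" using S A0[of k] by (simp add: u_def field_simps)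
      finally show ?thesis using C by simp
    qed
    finally show ?thesis .
  qed

  have upper_int: "integrable (gauss_vec D) (\<lambda>e. exp (v * (?R n e - \<kappa>)))" for n
    using residual_exponential_moment(1)[where D = D and l = l and \<alpha> = \<alpha>, OF pos D v(2)[unfolded S_def]] unfolding shift by (intro integrable_mult_right) simp
  have upper: "(\<integral>e. exp (v * (?R (i - 1) e - \<kappa>)) \<partial>gauss_vec D) \<le> (\<theta> i)\<^sup>2" if i: "i \<in> G" for i
  proof -
    have i1: "i - 1 \<le> D" "i - 1 + 1 = i" using subsetD[OF G i] by auto
    let ?B = "\<Sum>j=i..D. l j powr (2 * \<alpha>) * (l j * \<mu> j)\<^sup>2"
    have "(\<integral>e. exp (v * (?R (i - 1) e - \<kappa>)) \<partial>gauss_vec D)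
        = exp (- v * \<kappa>) * (\<integral>e. exp (v * ?R (i - 1) e) \<partial>gauss_vec D)"
      unfolding shift by simp
    also have "\<dots> \<le> exp (- v * \<kappa>) * exp (v * (\<Sum>j=i..D. l j powr (2 * \<alpha>)) + 1 / 8 + 2 * v * ?B)"
      using residual_exponential_moment(2)[where D = D and l = l and \<alpha> = \<alpha>, OF pos D v(2)[unfolded S_def], where \<mu> = \<mu> and n = "i - 1"] v(1)
      unfolding i1 by (intro mult_left_mono) (simp_all add: max_def)
    also have "\<dots> = exp (v * (A D - A (i - 1) - \<kappa> + 2 * ?B) + 1 / 8)"
      using Asplit[OF i1(1), unfolded i1] by (simp add: exp_add[symmetric] algebra_simps)
    also have "\<dots> \<le> exp (v * (- (A (i - 1) / 2)) + 1 / 8)"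
      using calib good[OF i] v(1) unfolding exp_le_cancel_iff
      by (intro add_right_mono mult_left_mono) (auto simp: abs_le_iff)
    also have "\<dots> = (\<theta> i)\<^sup>2"
      by (simp add: \<theta>_def v_def power2_eq_square exp_add[symmetric] field_simps)
    finally show ?thesis .
  qed

  define g where "g e = (\<Sum>i=k+1..D. (\<mu> i)\<^sup>2)
      + 2 * w * (exp (u * (\<kappa> - ?R k e)) / u)
      + 2 * (\<Sum>i=1..k. inverse ((l i)\<^sup>2) * (e i)\<^sup>2)
      + (\<Sum>i\<in>{1..D}-G. inverse ((l i)\<^sup>2) * (e i)\<^sup>2)
      + (\<Sum>i\<in>G. inverse ((l i)\<^sup>2) * ((\<theta> i * (e i)^4 + exp (v * (?R (i - 1) e - \<kappa>)) / \<theta> i) / 2))" for e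
  have \<theta>: "\<theta> i > 0" for i by (simp add: \<theta>_def)
  have sub: "i \<in> {1..D}" if "i \<in> {1..k} \<or> i \<in> {1..D} - G \<or> i \<in> G" for i
    using that k G by auto
  have ints:
    "integrable (gauss_vec D) (\<lambda>e. \<Sum>i=k+1..D. (\<mu> i)\<^sup>2)"
    "integrable (gauss_vec D) (\<lambda>e. 2 * w * (exp (u * (\<kappa> - ?R k e)) / u))"
    "integrable (gauss_vec D) (\<lambda>e. 2 * (\<Sum>i=1..k. inverse ((l i)\<^sup>2) * (e i)\<^sup>2))"
    "integrable (gauss_vec D) (\<lambda>e. \<Sum>i\<in>{1..D}-G. inverse ((l i)\<^sup>2) * (e i)\<^sup>2)"
    "integrable (gauss_vec D) (\<lambda>e. \<Sum>i\<in>G. inverse ((l i)\<^sup>2) *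
        ((\<theta> i * (e i)^4 + exp (v * (?R (i - 1) e - \<kappa>)) / \<theta> i) / 2))"
    by (intro P.integrable_const integrable_mult_right integrable_divide lower_int upper_int
        Bochner_Integration.integrable_sum Bochner_Integration.integrable_add gauss_vec_moments sub; simp)+
  have g_int: "integrable (gauss_vec D) g"
    unfolding g_def by (intro Bochner_Integration.integrable_add ints)
  have "stopped_risk \<alpha> D l 1 \<kappa> \<mu> \<le> integral\<^sup>L (gauss_vec D) g"
    unfolding stopped_risk_def
  proof (rule risk_integer_index_le[where l = l, OF stopping_time_le[OF \<kappa>] pos g_int])
    show "0 \<le> g e" for e
      unfolding g_def using u(1) \<theta> w(2)
      by (intro add_nonneg_nonneg sum_nonneg mult_nonneg_nonneg divide_nonneg_nonneg)
        (auto simp: less_imp_le)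
    fix e m assume m: "m = stopping_time \<alpha> D l \<kappa> (observation l 1 \<mu> e)"
    show "(\<Sum>i=1..m. inverse ((l i)\<^sup>2) * (e i)\<^sup>2) + (\<Sum>i=m+1..D. (\<mu> i)\<^sup>2) \<le> g e"
      using stopped_bias_le[OF \<kappa> u(1) k pos w refl m]
        stopped_variance_le[where \<theta> = \<theta> and e = e and l = l, OF \<kappa> v(1) G \<theta> m]
      unfolding g_def by linarith
  qed
  also have "integral\<^sup>L (gauss_vec D) g = (\<Sum>i=k+1..D. (\<mu> i)\<^sup>2)
      + 2 * w * ((\<integral>e. exp (u * (\<kappa> - ?R k e)) \<partial>gauss_vec D) / u)
      + 2 * (\<Sum>i=1..k. inverse ((l i)\<^sup>2))
      + (\<Sum>i\<in>{1..D}-G. inverse ((l i)\<^sup>2))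
      + (\<Sum>i\<in>G. inverse ((l i)\<^sup>2) *
          ((\<theta> i * 3 + (\<integral>e. exp (v * (?R (i - 1) e - \<kappa>)) \<partial>gauss_vec D) / \<theta> i) / 2))"
  proof -
    have "(\<integral>e. (\<Sum>i=k+1..D. (\<mu> i)\<^sup>2) \<partial>gauss_vec D) = (\<Sum>i=k+1..D. (\<mu> i)\<^sup>2)"
      using P.prob_space by simp
    moreover have sq: "(\<integral>e. (\<Sum>i\<in>I. inverse ((l i)\<^sup>2) * (e i)\<^sup>2) \<partial>gauss_vec D) = (\<Sum>i\<in>I. inverse ((l i)\<^sup>2))"
      if "I \<subseteq> {1..D}" for I
    proof -
      have I: "i \<in> {1..D}" if "i \<in> I" for i using that \<open>I \<subseteq> {1..D}\<close> by auto
      have "(\<integral>e. (\<Sum>i\<in>I. inverse ((l i)\<^sup>2) * (e i)\<^sup>2) \<partial>gauss_vec D)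
          = (\<Sum>i\<in>I. \<integral>e. inverse ((l i)\<^sup>2) * (e i)\<^sup>2 \<partial>gauss_vec D)"
        by (intro Bochner_Integration.integral_sum integrable_mult_right gauss_vec_moments I)
      also have "\<dots> = (\<Sum>i\<in>I. inverse ((l i)\<^sup>2))"
        using gauss_vec_moments(2)[OF I] by (intro sum.cong refl) simp
      finally show ?thesis .
    qed
    moreover have "(\<integral>e. (\<Sum>i\<in>G. inverse ((l i)\<^sup>2) *
          ((\<theta> i * (e i)^4 + exp (v * (?R (i - 1) e - \<kappa>)) / \<theta> i) / 2)) \<partial>gauss_vec D)
        = (\<Sum>i\<in>G. inverse ((l i)\<^sup>2) *
          ((\<theta> i * 3 + (\<integral>e. exp (v * (?R (i - 1) e - \<kappa>)) \<partial>gauss_vec D) / \<theta> i) / 2))"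
    proof -
      have "(\<integral>e. inverse ((l i)\<^sup>2) * ((\<theta> i * (e i)^4 + exp (v * (?R (i - 1) e - \<kappa>)) / \<theta> i) / 2) \<partial>gauss_vec D)
          = inverse ((l i)\<^sup>2) *
            ((\<theta> i * 3 + (\<integral>e. exp (v * (?R (i - 1) e - \<kappa>)) \<partial>gauss_vec D) / \<theta> i) / 2)" if i: "i \<in> G" for i
      proof -
        have iD: "i \<in> {1..D}" using i sub by blast
        have "(\<integral>e. \<theta> i * (e i)^4 + exp (v * (?R (i - 1) e - \<kappa>)) / \<theta> i \<partial>gauss_vec D)
            = (\<integral>e. \<theta> i * (e i)^4 \<partial>gauss_vec D) + (\<integral>e. exp (v * (?R (i - 1) e - \<kappa>)) / \<theta> i \<partial>gauss_vec D)"
          by (intro Bochner_Integration.integral_add integrable_mult_right integrable_divide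
              gauss_vec_moments(3)[OF iD] upper_int)
        also have "\<dots> = \<theta> i * 3 + (\<integral>e. exp (v * (?R (i - 1) e - \<kappa>)) \<partial>gauss_vec D) / \<theta> i"
          using gauss_vec_moments(4)[OF iD] by simp
        finally show ?thesis by simp
      qed
      note coordinate = this
      show ?thesis
      proof (subst Bochner_Integration.integral_sum)
        show "integrable (gauss_vec D) (\<lambda>e. inverse ((l i)\<^sup>2) *
            ((\<theta> i * (e i)^4 + exp (v * (?R (i - 1) e - \<kappa>)) / \<theta> i) / 2))" if i: "i \<in> G" for i
          using i sub by (intro integrable_mult_right integrable_divide Bochner_Integration.integrable_add
            gauss_vec_moments(3) upper_int) blast
      qed (rule sum.cong[OF refl coordinate])
    qed
    moreover have "integral\<^sup>L (gauss_vec D) g = (\<integral>e. (\<Sum>i=k+1..D. (\<mu> i)\<^sup>2) \<partial>gauss_vec D)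
      + (\<integral>e. 2 * w * (exp (u * (\<kappa> - ?R k e)) / u) \<partial>gauss_vec D)
      + (\<integral>e. 2 * (\<Sum>i=1..k. inverse ((l i)\<^sup>2) * (e i)\<^sup>2) \<partial>gauss_vec D)
      + (\<integral>e. (\<Sum>i\<in>{1..D}-G. inverse ((l i)\<^sup>2) * (e i)\<^sup>2) \<partial>gauss_vec D)
      + (\<integral>e. (\<Sum>i\<in>G. inverse ((l i)\<^sup>2) *
          ((\<theta> i * (e i)^4 + exp (v * (?R (i - 1) e - \<kappa>)) / \<theta> i) / 2)) \<partial>gauss_vec D)"
      unfolding g_def by (simp only: Bochner_Integration.integral_add Bochner_Integration.integrable_add ints)
    moreover have "(\<integral>e. 2 * (\<Sum>i=1..k. inverse ((l i)\<^sup>2) * (e i)\<^sup>2) \<partial>gauss_vec D)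
        = 2 * (\<Sum>i=1..k. inverse ((l i)\<^sup>2))"
      using sq[of "{1..k}"] k by (simp only: integral_mult_right_zero) simp
    moreover have "(\<integral>e. 2 * w * (exp (u * (\<kappa> - ?R k e)) / u) \<partial>gauss_vec D)
        = 2 * w * ((\<integral>e. exp (u * (\<kappa> - ?R k e)) \<partial>gauss_vec D) / u)"
      by (simp only: integral_mult_right_zero integral_divide_zero)
    ultimately show ?thesis
      using sq[OF Diff_subset[of "{1..D}" G]] by presburger
  qed
  also have "\<dots> \<le> (\<Sum>i=k+1..D. (\<mu> i)\<^sup>2)
      + 2 * w * (exp (C\<^sub>\<kappa> + 1) / u)
      + 2 * (\<Sum>i=1..k. inverse ((l i)\<^sup>2))
      + (\<Sum>i\<in>{1..D}-G. inverse ((l i)\<^sup>2))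
      + (\<Sum>i\<in>G. inverse ((l i)\<^sup>2) * ((\<theta> i * 3 + (\<theta> i)\<^sup>2 / \<theta> i) / 2))"
    using u(1) \<theta> w(2)
    by (intro add_mono order_refl mult_left_mono divide_right_mono lower sum_mono upper)
      (auto simp: less_imp_le)
  also have "2 * w * (exp (C\<^sub>\<kappa> + 1) / u)
      = 8 * exp (C\<^sub>\<kappa> + 1) * (w * (S + A k))"
    by (simp add: u_def)
  also have "(\<Sum>i\<in>G. inverse ((l i)\<^sup>2) * ((\<theta> i * 3 + (\<theta> i)\<^sup>2 / \<theta> i) / 2))
      = (\<Sum>i\<in>G. inverse ((l i)\<^sup>2) * (2 * exp (1 / 16 - A (i - 1) / (16 * S))))"
    using \<theta> by (intro sum.cong refl) (simp add: \<theta>_def power2_eq_square)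
  finally show ?thesis .
qed

section \<open>Sums of powers\<close>

text \<open>
  Comparing a sum of powers with an integral, one step at a time.
\<close>

lemma powr_diff_mean_value:
  fixes x r :: real
  assumes "x > 0"
  obtains z where "x < z" "z < x + 1" "(x + 1) powr r - x powr r = r * z powr (r - 1)"
proof -
  have "\<exists>z. x < z \<and> z < x + 1 \<and> (x + 1) powr r - x powr r = (x + 1 - x) * (r * z powr (r - 1))"
    using assms by (intro MVT2) (auto intro!: has_real_derivative_powr)
  then show ?thesis using that by auto
qed

lemma sum_powr_ge:
  assumes q: "q \<ge> 1"
  shows "real n powr q \<le> q * (\<Sum>i=1..n. real i powr (q - 1))"
proof (induction n)
  case 0 then show ?case by simp
next
  case (Suc n)
  have "real (Suc n) powr q - real n powr q \<le> q * real (Suc n) powr (q - 1)"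
  proof (cases "n = 0")
    case True then show ?thesis using q by simp
  next
    case False
    then obtain z where z: "real n < z" "z < real n + 1"
      and e: "(real n + 1) powr q - real n powr q = q * z powr (q - 1)"
      using powr_diff_mean_value[of "real n" q] by auto
    have "z powr (q - 1) \<le> (real n + 1) powr (q - 1)"
      using z q by (intro powr_mono2) auto
    then have "q * z powr (q - 1) \<le> q * (real n + 1) powr (q - 1)"
      using q by (intro mult_left_mono) auto
    then show ?thesis using e by (simp add: add.commute)
  qed
  then show ?case using Suc by (simp add: distrib_left)
qed

lemma sum_powr_le:
  assumes b: "0 < b" "b \<le> 1"
  shows "b * (\<Sum>i=1..n. real i powr (b - 1)) \<le> real n powr b"
proof (induction n)
  case 0 then show ?case by simp
next
  case (Suc n)
  have "b * real (Suc n) powr (b - 1) \<le> real (Suc n) powr b - real n powr b"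
  proof (cases "n = 0")
    case True then show ?thesis using b by simp
  next
    case False
    then obtain z where z: "real n < z" "z < real n + 1"
      and e: "(real n + 1) powr b - real n powr b = b * z powr (b - 1)"
      using powr_diff_mean_value[of "real n" b] by auto
    have "(real n + 1) powr (b - 1) \<le> z powr (b - 1)"
      using z b by (intro powr_mono2') auto
    then have "b * (real n + 1) powr (b - 1) \<le> b * z powr (b - 1)"
      using b by (intro mult_left_mono) auto
    then show ?thesis using e by (simp add: add.commute)
  qed
  then show ?case using Suc by (simp add: distrib_left)
qed

lemma exp_minus_le_powr:
  fixes x r :: real
  assumes "x > 0" "r > 0"
  shows "exp (- x) \<le> (r / x) powr r"
proof -
  have "x / r \<le> exp (x / r)" using exp_ge_add_one_self[of "x / r"] by linarith
  then have "(x / r) powr r \<le> exp (x / r) powr r"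
    using assms by (intro powr_mono2) auto
  also have "\<dots> = exp x" using assms by (simp add: powr_def)
  finally show ?thesis
    using assms by (simp add: powr_divide exp_minus field_simps)
qed

lemma sum_inverse_square_tail:
  fixes M :: real
  assumes "finite F" "M \<ge> 1" "\<And>n. n \<in> F \<Longrightarrow> M \<le> real n"
  shows "(\<Sum>n\<in>F. 1 / (real n)\<^sup>2) \<le> 2 / M"
proof -
  define a where "a = nat \<lceil>M\<rceil>"
  have a: "M \<le> real a" "a \<ge> 1" using assms(2) unfolding a_def by linarith+
  have tele: "(\<Sum>n=a..<a+j. 1 / (real n)\<^sup>2) \<le> 2 * (1 / real a - 1 / real (a + j))" for j
  proof (induction j)
    case 0 then show ?case by simp
  next
    case (Suc j)
    have y: "real (a + j) \<ge> 1" using a by simp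
    have "1 / y\<^sup>2 \<le> 2 * (1 / y - 1 / (y + 1))" if "y \<ge> 1" for y :: real
    proof -
      have "y * (y + 1) \<le> 2 * y\<^sup>2" using that by (simp add: power2_eq_square)
      then have "1 / y\<^sup>2 \<le> 2 / (y * (y + 1))" using that by (simp add: divide_simps)
      also have "\<dots> = 2 * (1 / y - 1 / (y + 1))" using that by (simp add: field_simps)
      finally show ?thesis .
    qed
    from this[OF y] show ?case using Suc by (simp add: add.commute add.left_commute)
  qed
  obtain b where b: "\<And>n. n \<in> F \<Longrightarrow> n < b" using assms(1) finite_nat_bounded by blast
  have "F \<subseteq> {a..<a+b}"
  proof
    fix n assume n: "n \<in> F"
    have "a \<le> n" using assms(3)[OF n] unfolding a_def by linarith
    then show "n \<in> {a..<a+b}" using b[OF n] by auto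
  qed
  then have "(\<Sum>n\<in>F. 1 / (real n)\<^sup>2) \<le> (\<Sum>n=a..<a+b. 1 / (real n)\<^sup>2)"
    by (intro sum_mono2) auto
  also have "\<dots> \<le> 2 / real a" 
  proof -
    have "0 \<le> 1 / real (a + b)" by simp
    then show ?thesis using tele[of b] by argo
  qed
  also have "\<dots> \<le> 2 / M" using a assms(2) by (intro divide_left_mono) auto
  finally show ?thesis .
qed

lemma powr_between:
  fixes x y C r :: real
  assumes C: "C \<ge> 1" and y: "y > 0" and x: "inverse C * y \<le> x" "x \<le> C * y" and r: "r \<ge> 0"
  shows "x powr r \<le> C powr r * y powr r" "C powr (- r) * y powr r \<le> x powr r"
    "x powr (- r) \<le> C powr r * y powr (- r)" "C powr (- r) * y powr (- r) \<le> x powr (- r)"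
proof -
  have iC: "inverse C > 0" using C by simp
  then have x0: "x > 0" using x(1) y by (meson less_le_trans mult_pos_pos)
  show up: "x powr r \<le> C powr r * y powr r"
    using powr_mono2[OF r _ x(2)] x0 C y by (simp add: powr_mult)
  show lo: "C powr (- r) * y powr r \<le> x powr r"
    using powr_mono2[OF r _ x(1)] iC C y by (simp add: powr_mult powr_minus inverse_powr)
  have p: "x powr r > 0" "y powr r > 0" "C powr r > 0" using x0 y C by auto
  show "x powr (- r) \<le> C powr r * y powr (- r)" "C powr (- r) * y powr (- r) \<le> x powr (- r)"
    using up lo p by (auto simp: powr_minus field_simps)
qed

text \<open>
  The closed half line is essential: interpolation between integers starts at \<open>0\<close>.
\<close>

lemma powr_convex_combination:
  fixes x y \<theta> q :: real
  assumes q: "q \<ge> 1" and \<theta>: "0 \<le> \<theta>" "\<theta> \<le> 1" and xy: "x \<ge> 0" "y \<ge> 0"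
  shows "((1 - \<theta>) * x + \<theta> * y) powr q \<le> (1 - \<theta>) * x powr q + \<theta> * y powr q"
proof -
  have scale: "(s * z) powr q \<le> s * z powr q" if "0 \<le> s" "s \<le> 1" "z \<ge> 0" for s z :: real
  proof -
    have "s powr q \<le> s powr 1" using that q by (intro powr_mono') auto
    then show ?thesis using that by (simp add: powr_mult mult_right_mono)
  qed
  consider "x = 0" | "y = 0" | "x > 0" "y > 0" using xy by linarith
  then show ?thesis
  proof cases
    case 1 then show ?thesis using scale[OF \<theta> xy(2)] by simp
  next
    case 2 then show ?thesis using scale[of "1 - \<theta>" x] \<theta> xy by simp
  next
    case 3 then show ?thesis using convex_onD[OF powr_convex[OF q] \<theta>, of x y] by simp
  qed
qed

section \<open>The rate of the stopped risk\<close>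

lemma singular_value_powr_bounds:
  assumes set: "setting p C\<^sub>A C\<^sub>\<kappa> \<alpha> D \<delta> l \<kappa>" and C\<^sub>A: "C\<^sub>A \<ge> 1" and i: "i \<in> {1..D}" and r: "r \<ge> 0"
  shows "l i powr r \<le> C\<^sub>A powr r * real i powr (- (p * r))"
    "C\<^sub>A powr (- r) * real i powr (- (p * r)) \<le> l i powr r"
    "l i powr (- r) \<le> C\<^sub>A powr r * real i powr (p * r)"
    "C\<^sub>A powr (- r) * real i powr (p * r) \<le> l i powr (- r)"
proof -
  have y: "real i powr (- p) > 0" using i by simp
  have x: "inverse C\<^sub>A * real i powr (- p) \<le> l i" "l i \<le> C\<^sub>A * real i powr (- p)"
    using set i by (auto simp: setting_def)
  show "l i powr r \<le> C\<^sub>A powr r * real i powr (- (p * r))"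
    "C\<^sub>A powr (- r) * real i powr (- (p * r)) \<le> l i powr r"
    "l i powr (- r) \<le> C\<^sub>A powr r * real i powr (p * r)"
    "C\<^sub>A powr (- r) * real i powr (p * r) \<le> l i powr (- r)"
    using powr_between[OF C\<^sub>A y x r] by (simp_all add: powr_powr)
qed

lemma inverse_square_bounds:
  assumes set: "setting p C\<^sub>A C\<^sub>\<kappa> \<alpha> D \<delta> l \<kappa>" and C\<^sub>A: "C\<^sub>A \<ge> 1" and i: "i \<in> {1..D}"
  shows "inverse ((l i)\<^sup>2) \<le> C\<^sub>A\<^sup>2 * real i powr (2 * p)"
    "real i powr (2 * p) \<le> C\<^sub>A\<^sup>2 * inverse ((l i)\<^sup>2)"
proof -
  have l: "l i > 0" using set i by (simp add: setting_def)
  have e: "l i powr (- 2) = inverse ((l i)\<^sup>2)" "C\<^sub>A powr 2 = C\<^sub>A\<^sup>2" "C\<^sub>A powr (- 2) = inverse (C\<^sub>A\<^sup>2)"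
    using l C\<^sub>A powr_realpow[of "l i" 2] powr_realpow[of C\<^sub>A 2] by (simp_all add: powr_minus)
  show "inverse ((l i)\<^sup>2) \<le> C\<^sub>A\<^sup>2 * real i powr (2 * p)"
    using singular_value_powr_bounds(3)[OF set C\<^sub>A i, of 2] by (simp add: e mult.commute)
  show "real i powr (2 * p) \<le> C\<^sub>A\<^sup>2 * inverse ((l i)\<^sup>2)"
    using singular_value_powr_bounds(4)[OF set C\<^sub>A i, of 2] C\<^sub>A by (simp add: e field_simps)
qed

text \<open>
  The total variance up to index \<open>k\<close> has the exact order \<open>k powr (2 * p + 1)\<close>; this is the direction that turns
  powers of an index into risk.
\<close>

lemma index_powr_le_variance:
  assumes set: "setting p C\<^sub>A C\<^sub>\<kappa> \<alpha> D \<delta> l \<kappa>" and p: "p \<ge> 0" and C\<^sub>A: "C\<^sub>A \<ge> 1" and k: "k \<le> D"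
  shows "real k powr (2 * p + 1) \<le> (2 * p + 1) * C\<^sub>A\<^sup>2 * (\<Sum>i=1..k. inverse ((l i)\<^sup>2))"
proof -
  have q: "2 * p + 1 \<ge> 1" using p by simp
  have "real k powr (2 * p + 1) \<le> (2 * p + 1) * (\<Sum>i=1..k. real i powr (2 * p))"
    using sum_powr_ge[OF q, of k] by simp
  also have "\<dots> \<le> (2 * p + 1) * (\<Sum>i=1..k. C\<^sub>A\<^sup>2 * inverse ((l i)\<^sup>2))"
    using p k inverse_square_bounds(2)[OF set C\<^sub>A] by (intro mult_left_mono sum_mono) auto
  finally show ?thesis by (simp add: sum_distrib_left mult.assoc)
qed

text \<open>
  The rates. All constants depend on \<open>p\<close>, \<open>\<alpha>\<close>, \<open>C\<^sub>A\<close> and \<open>C\<^sub>\<kappa>\<close> only. \<open>C1\<close> makes the calibration error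
  \<open>C\<^sub>\<kappa> * S\<close> at most a quarter of \<open>A n\<close> for \<open>n \<ge> C1 * K\<close> and \<open>C2\<close> does the same for twice the remaining
  signal when \<open>n \<ge> k\<close> and \<open>n powr q \<ge> C2 * B\<close>; together they are the condition under which the variance tail is
  exponentially small. \<open>N1\<close>, \<open>N2\<close> and \<open>E\<close> collect the factors from the premature stopping, the indices
  up to the threshold \<open>M\<close>, and the tail beyond it.
\<close>

lemma stopped_risk_rate:
  assumes p: "p \<ge> 0" and C\<^sub>A: "C\<^sub>A \<ge> 1" and C\<^sub>\<kappa>: "C\<^sub>\<kappa> > 0" and \<alpha>: "\<alpha> \<ge> 0" and \<alpha>p: "\<alpha> * p < 1 / 2"
  shows "\<exists>C>0. \<forall>D l \<kappa> \<mu> k. setting p C\<^sub>A C\<^sub>\<kappa> \<alpha> D 1 l \<kappa> \<longrightarrow> k \<le> D \<longrightarrow>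
    stopped_risk \<alpha> D l 1 \<kappa> \<mu> \<le> C * ((\<Sum>i=k+1..D. (\<mu> i)\<^sup>2) + (\<Sum>i=1..k. inverse ((l i)\<^sup>2))
      + s_D \<alpha> D l powr ((2 * p + 1) / (1 - 2 * \<alpha> * p)))"
proof -
  define \<beta> q where "\<beta> = 1 - 2 * \<alpha> * p" and "q = 2 * p + 1"
  define c where "c = C\<^sub>A powr (2 * \<alpha>)"
  define H where "H = C\<^sub>A powr (2 + 2 * \<alpha>)"
  define C1 where "C1 = (c * (1 + 4 * C\<^sub>\<kappa>)) powr (1 / \<beta>)"
  define C2 where "C2 = 8 * c * H"
  define r where "r = (2 * p + 2) / \<beta>"
  define N1 where "N1 = 8 * exp (C\<^sub>\<kappa> + 1) * (H * (1 + c / \<beta>))"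
  define N2 where "N2 = C\<^sub>A\<^sup>2 * 2 powr q"
  define E where "E = 2 * exp (1 / 16) * C\<^sub>A\<^sup>2 * 2 powr (2 * p) * (16 * c * r) powr r"
  define Ctot where "Ctot = (1 + N2 * C2) + (2 + (N1 + N2) * (q * C\<^sub>A\<^sup>2)) + (N1 + N2 * C1 powr q + 2 * E)"
  have \<beta>: "0 < \<beta>" "\<beta> \<le> 1" using \<alpha>p p \<alpha> by (auto simp: \<beta>_def)
  have q: "q \<ge> 1" using p by (simp add: q_def)
  have c1: "c \<ge> 1" using C\<^sub>A \<alpha> by (simp add: c_def ge_one_powr_ge_zero)
  have H0: "H > 0" using C\<^sub>A by (simp add: H_def)
  have r0: "r > 0" using p \<beta> by (simp add: r_def)
  have cC: "c * (1 + 4 * C\<^sub>\<kappa>) \<ge> 1"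
    using mult_mono[of 1 c 1 "1 + 4 * C\<^sub>\<kappa>"] c1 C\<^sub>\<kappa> by simp
  have C1: "C1 \<ge> 1" unfolding C1_def using cC \<beta> by (intro ge_one_powr_ge_zero) auto
  have C1\<beta>: "C1 powr \<beta> = c * (1 + 4 * C\<^sub>\<kappa>)"
    using cC \<beta> by (simp add: C1_def powr_powr)
  have C2: "C2 > 0" using c1 H0 by (simp add: C2_def)
  have N: "N1 > 0" "N2 > 0" "E > 0"
    using c1 \<beta> H0 C\<^sub>A r0 by (auto simp: N1_def N2_def E_def intro!: mult_pos_pos add_pos_pos)
  have tot: "Ctot > 0" unfolding Ctot_def using N C2 q C1
    by (intro add_pos_pos mult_pos_pos add_pos_nonneg mult_nonneg_nonneg) (auto intro!: add_nonneg_nonneg)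
  have exponent: "2 * p + 2 * \<alpha> * p + \<beta> = q" by (simp add: \<beta>_def q_def)

  have "stopped_risk \<alpha> D l 1 \<kappa> \<mu> \<le> Ctot * ((\<Sum>i=k+1..D. (\<mu> i)\<^sup>2) + (\<Sum>i=1..k. inverse ((l i)\<^sup>2))
      + s_D \<alpha> D l powr ((2 * p + 1) / (1 - 2 * \<alpha> * p)))"
    if set: "setting p C\<^sub>A C\<^sub>\<kappa> \<alpha> D 1 l \<kappa>" and k: "k \<le> D" for D l \<kappa> \<mu> k
  proof -
    have D: "D \<ge> 1" and pos: "\<And>i. i \<in> {1..D} \<Longrightarrow> 0 < l i" and \<kappa>: "\<kappa> > 0"
      using set by (auto simp: setting_def)
    define S where "S = s_D \<alpha> D l"
    define A where "A n = (\<Sum>i=1..n. l i powr (2 * \<alpha>))" for n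
    define K where "K = S powr (1 / \<beta>)"
    define B where "B = (\<Sum>i=k+1..D. (\<mu> i)\<^sup>2)"
    define V where "V = (\<Sum>i=1..k. inverse ((l i)\<^sup>2))"
    define W where "W = real k powr q + (C1 * K) powr q + C2 * B"
    define M where "M = W powr (1 / q)"
    define G where "G = {i \<in> {1..D}. M + 1 \<le> real i}"
    have calib: "\<bar>\<kappa> - A D\<bar> \<le> C\<^sub>\<kappa> * S"
      using set by (simp add: setting_def A_def S_def)
    have S: "S > 0" using s_D_properties(1)[where D = D and l = l, OF pos D] by (simp add: S_def)
    have K: "K > 0" "K powr \<beta> = S" using S \<beta> by (auto simp: K_def powr_powr)
    have B: "B \<ge> 0" by (simp add: B_def sum_nonneg)
    have CK: "(C1 * K) powr \<beta> = c * (1 + 4 * C\<^sub>\<kappa>) * S" using C1 K by (simp add: powr_mult C1\<beta>)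

    have A_ge: "real n powr \<beta> \<le> c * A n" if n: "n \<le> D" for n
    proof (cases "n = 0")
      case True then show ?thesis by (simp add: A_def)
    next
      case False
      have "real n powr \<beta> = (\<Sum>i=1..n. real n powr (\<beta> - 1))"
        using False by (simp add: powr_diff)
      also have "\<dots> \<le> (\<Sum>i=1..n. c * l i powr (2 * \<alpha>))"
      proof (rule sum_mono)
        fix i assume i: "i \<in> {1..n}"
        have "real n powr (\<beta> - 1) \<le> real i powr (\<beta> - 1)"
          using i \<beta> by (intro powr_mono2') auto
        also have "\<dots> = c * (C\<^sub>A powr (- (2 * \<alpha>)) * real i powr (- (p * (2 * \<alpha>))))"
          using C\<^sub>A by (simp add: c_def \<beta>_def powr_minus mult_ac)
        also have "\<dots> \<le> c * l i powr (2 * \<alpha>)"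
          using i n \<alpha> c1 by (intro mult_left_mono singular_value_powr_bounds(2)[OF set C\<^sub>A]) auto
        finally show "real n powr (\<beta> - 1) \<le> c * l i powr (2 * \<alpha>)" .
      qed
      finally show ?thesis by (simp add: A_def sum_distrib_left)
    qed
    have A_le: "A n \<le> c / \<beta> * real n powr \<beta>" if n: "n \<le> D" for n
    proof -
      have "A n \<le> (\<Sum>i=1..n. c * real i powr (\<beta> - 1))"
        unfolding A_def
      proof (rule sum_mono)
        fix i assume "i \<in> {1..n}"
        then show "l i powr (2 * \<alpha>) \<le> c * real i powr (\<beta> - 1)"
          using singular_value_powr_bounds(1)[OF set C\<^sub>A, of i "2 * \<alpha>"] n \<alpha> by (simp add: c_def \<beta>_def mult_ac)
      qed
      also have "\<dots> = c / \<beta> * (\<beta> * (\<Sum>i=1..n. real i powr (\<beta> - 1)))"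
        using \<beta> by (simp add: sum_distrib_left)
      also have "\<dots> \<le> c / \<beta> * real n powr \<beta>"
        using sum_powr_le[OF \<beta>] \<beta> c1 by (intro mult_left_mono) auto
      finally show ?thesis .
    qed

    have CK1: "C1 * K \<ge> 1"
    proof -
      have "1 \<le> c * A 1" using A_ge[of 1] D by simp
      moreover have "A 1 \<le> S"
        using s_D_properties(3)[where D = D and l = l and \<alpha> = \<alpha> and i = 1, OF pos D] D by (simp add: A_def S_def)
      ultimately have "1 \<le> c * S" using c1 mult_left_mono[of "A 1" S c] by linarith
      also have "\<dots> \<le> c * (1 + 4 * C\<^sub>\<kappa>) * S" using C\<^sub>\<kappa> c1 S by simp
      finally have "1 \<le> (C1 * K) powr \<beta>" by (simp add: CK)
      then have "1 powr (1 / \<beta>) \<le> ((C1 * K) powr \<beta>) powr (1 / \<beta>)"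
        using \<beta> by (intro powr_mono2) auto
      then show ?thesis using \<beta> C1 K by (simp add: powr_powr)
    qed
    have W0: "W > 0"
    proof -
      have "(C1 * K) powr q > 0" "0 \<le> C2 * B" using CK1 B C2 by auto
      then show ?thesis by (simp add: W_def add_nonneg_pos add_pos_nonneg)
    qed
    have Mq: "M powr q = W" using W0 q by (simp add: M_def powr_powr)
    have root_le: "x \<le> M" if "x powr q \<le> W" "x \<ge> 0" for x
    proof -
      have "(x powr q) powr (1 / q) \<le> M" unfolding M_def using that q by (intro powr_mono2) auto
      then show ?thesis using that q by (simp add: powr_powr)
    qed
    have kM: "real k \<le> M" and CKM: "C1 * K \<le> M"
      using B C2 C1 K by (auto intro!: root_le simp: W_def)
    have M1: "M \<ge> 1" using CKM CK1 by simp

    have good: "2 * (\<Sum>j=i..D. l j powr (2 * \<alpha>) * (l j * \<mu> j)\<^sup>2) + C\<^sub>\<kappa> * S \<le> A (i - 1) / 2" if i: "i \<in> G" for i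
    proof -
      define n where "n = i - 1"
      have n: "i = n + 1" "M \<le> real n" "n \<le> D" "1 \<le> n" "k \<le> n"
        using i M1 kM by (auto simp: G_def n_def)
      have "(C1 * K) powr \<beta> \<le> real n powr \<beta>"
        using CKM n C1 K \<beta> by (intro powr_mono2) auto
      then have "c * ((1 + 4 * C\<^sub>\<kappa>) * S) \<le> c * A n"
        using A_ge[OF n(3)] by (simp add: CK mult.assoc)
      then have "(1 + 4 * C\<^sub>\<kappa>) * S \<le> A n" using c1 by simp
      then have 1: "C\<^sub>\<kappa> * S \<le> A n / 4" using S by (simp add: algebra_simps)
      let ?h = "H * real n powr (- (p * (2 + 2 * \<alpha>)))"
      have "(\<Sum>j=i..D. l j powr (2 * \<alpha>) * (l j * \<mu> j)\<^sup>2) \<le> (\<Sum>j=i..D. ?h * (\<mu> j)\<^sup>2)"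
      proof (rule sum_mono)
        fix j assume j: "j \<in> {i..D}"
        then have jD: "j \<in> {1..D}" using n by auto
        have "l j powr (2 * \<alpha>) * (l j)\<^sup>2 = l j powr (2 + 2 * \<alpha>)"
          using pos[OF jD] powr_realpow[of "l j" 2] by (simp add: powr_add)
        also have "\<dots> \<le> H * real j powr (- (p * (2 + 2 * \<alpha>)))"
          unfolding H_def using \<alpha> by (intro singular_value_powr_bounds(1)[OF set C\<^sub>A jD]) auto
        also have "\<dots> \<le> ?h"
          using j n p \<alpha> H0 by (intro mult_left_mono powr_mono2') auto
        finally have "l j powr (2 * \<alpha>) * (l j)\<^sup>2 * (\<mu> j)\<^sup>2 \<le> ?h * (\<mu> j)\<^sup>2"
          by (rule mult_right_mono) simp
        then show "l j powr (2 * \<alpha>) * (l j * \<mu> j)\<^sup>2 \<le> ?h * (\<mu> j)\<^sup>2"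
          by (simp add: power_mult_distrib mult.assoc)
      qed
      also have "\<dots> = ?h * (\<Sum>j=i..D. (\<mu> j)\<^sup>2)" by (simp add: sum_distrib_left)
      also have "\<dots> \<le> ?h * B"
        unfolding B_def using n H0 by (intro mult_left_mono sum_mono2) auto
      finally have 2: "(\<Sum>j=i..D. l j powr (2 * \<alpha>) * (l j * \<mu> j)\<^sup>2) \<le> ?h * B" .
      have "C2 * B \<le> W" using K by (simp add: W_def)
      also have "\<dots> \<le> real n powr q" unfolding Mq[symmetric] using n M1 q by (intro powr_mono2) auto
      finally have "8 * c * (H * B) \<le> real n powr q" by (simp add: C2_def mult_ac)
      then have "8 * c * (H * B) * real n powr (- (p * (2 + 2 * \<alpha>)))
          \<le> real n powr q * real n powr (- (p * (2 + 2 * \<alpha>)))" by (rule mult_right_mono) simp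
      also have "\<dots> = real n powr \<beta>"
        by (simp add: powr_add[symmetric] exponent[symmetric] algebra_simps)
      also have "\<dots> \<le> c * A n" by (rule A_ge[OF n(3)])
      finally have "c * (8 * (?h * B)) \<le> c * A n" by (simp add: mult_ac)
      then have "8 * (?h * B) \<le> A n" using c1 by simp
      then show ?thesis using 1 2 by (simp add: n_def)
    qed

    have k_le: "real k powr q \<le> q * C\<^sub>A\<^sup>2 * V"
      using index_powr_le_variance[OF set p C\<^sub>A k] by (simp add: q_def V_def)

    let ?w = "H * real k powr (p * (2 + 2 * \<alpha>))"
    have w: "l i powr (- (2 + 2 * \<alpha>)) \<le> ?w" if i: "i \<in> {1..k}" for i
    proof -
      have "l i powr (- (2 + 2 * \<alpha>)) \<le> H * real i powr (p * (2 + 2 * \<alpha>))"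
        unfolding H_def using i k \<alpha> by (intro singular_value_powr_bounds(3)[OF set C\<^sub>A]) auto
      also have "\<dots> \<le> ?w" using i p \<alpha> H0 by (intro mult_left_mono powr_mono2) auto
      finally show ?thesis .
    qed
    have w0: "?w \<ge> 0" using H0 by simp

    note main = stopped_risk_le_terms[where l = l and \<mu> = \<mu> and G = G, OF D \<kappa> k less_imp_le[OF C\<^sub>\<kappa>] pos w w0
        S_def A_def calib _ good]
    have "stopped_risk \<alpha> D l 1 \<kappa> \<mu> \<le> B + 8 * exp (C\<^sub>\<kappa> + 1) * (?w * (S + A k)) + 2 * V
        + (\<Sum>i\<in>{1..D}-G. inverse ((l i)\<^sup>2))
        + (\<Sum>i\<in>G. inverse ((l i)\<^sup>2) * (2 * exp (1 / 16 - A (i - 1) / (16 * S))))"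
      unfolding B_def V_def by (rule main) (auto simp: G_def)
    moreover have "8 * exp (C\<^sub>\<kappa> + 1) * (?w * (S + A k)) \<le> N1 * (real k powr q + K powr q)"
    proof -
      (* every power of k and K is bounded by one of z, whose exponents add up to q *)
      define z where "z = max (real k) K"
      have z: "real k \<le> z" "K \<le> z" "0 < z" using K by (auto simp: z_def)
      have zq: "z powr q \<le> real k powr q + K powr q" by (auto simp: z_def max_def)
      have "real k powr \<beta> \<le> z powr \<beta>" "K powr \<beta> \<le> z powr \<beta>"
        using z K \<beta> by (auto intro!: powr_mono2)
      moreover have "c / \<beta> * real k powr \<beta> \<le> c / \<beta> * z powr \<beta>"
        using calculation(1) c1 \<beta> by (intro mult_left_mono) auto
      ultimately have "S + A k \<le> (1 + c / \<beta>) * z powr \<beta>"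
        using A_le[OF k] K by (simp add: algebra_simps)
      moreover have "real k powr (p * (2 + 2 * \<alpha>)) \<le> z powr (p * (2 + 2 * \<alpha>))"
        using z p \<alpha> by (intro powr_mono2) auto
      ultimately have "?w * (S + A k) \<le> (H * z powr (p * (2 + 2 * \<alpha>))) * ((1 + c / \<beta>) * z powr \<beta>)"
        using H0 S by (intro mult_mono mult_left_mono) (auto simp: A_def sum_nonneg intro!: add_nonneg_nonneg)
      also have "\<dots> = H * (1 + c / \<beta>) * z powr q"
        by (simp add: exponent[symmetric] powr_add algebra_simps)
      also have "\<dots> \<le> H * (1 + c / \<beta>) * (real k powr q + K powr q)"
        using zq H0 c1 \<beta> by (intro mult_left_mono) auto
      finally show ?thesis unfolding N1_def by (simp add: mult.assoc)
    qed
    moreover have "(\<Sum>i\<in>{1..D}-G. inverse ((l i)\<^sup>2)) \<le> N2 * W"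
    proof -
      define b where "b = nat \<lfloor>M + 1\<rfloor>"
      have bM: "real b \<le> M + 1" unfolding b_def using M1 by simp
      have "i \<le> b" if "i \<in> {1..D} - G" for i
        unfolding b_def using that by (intro le_nat_floor) (auto simp: G_def)
      then have sub: "{1..D} - G \<subseteq> {1..b}" by auto
      have "(\<Sum>i\<in>{1..D}-G. inverse ((l i)\<^sup>2)) \<le> (\<Sum>i\<in>{1..D}-G. C\<^sub>A\<^sup>2 * (M + 1) powr (2 * p))"
      proof (rule sum_mono)
        fix i assume i: "i \<in> {1..D} - G"
        have "inverse ((l i)\<^sup>2) \<le> C\<^sub>A\<^sup>2 * real i powr (2 * p)"
          using i by (intro inverse_square_bounds(1)[OF set C\<^sub>A]) auto
        also have "\<dots> \<le> C\<^sub>A\<^sup>2 * (M + 1) powr (2 * p)"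
          using i p by (intro mult_left_mono powr_mono2) (auto simp: G_def)
        finally show "inverse ((l i)\<^sup>2) \<le> C\<^sub>A\<^sup>2 * (M + 1) powr (2 * p)" .
      qed
      also have "\<dots> = real (card ({1..D} - G)) * (C\<^sub>A\<^sup>2 * (M + 1) powr (2 * p))" by simp
      also have "\<dots> \<le> (M + 1) * (C\<^sub>A\<^sup>2 * (M + 1) powr (2 * p))"
        using card_mono[OF _ sub] bM by (intro mult_right_mono) auto
      also have "\<dots> = C\<^sub>A\<^sup>2 * (M + 1) powr q" using M1 by (simp add: q_def powr_add)
      also have "\<dots> \<le> C\<^sub>A\<^sup>2 * (2 * M) powr q" using M1 q by (intro mult_left_mono powr_mono2) auto
      also have "\<dots> = N2 * W" using M1 by (simp add: powr_mult Mq N2_def)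
      finally show ?thesis .
    qed
    moreover have "(\<Sum>i\<in>G. inverse ((l i)\<^sup>2) * (2 * exp (1 / 16 - A (i - 1) / (16 * S)))) \<le> 2 * E * K powr q"
    proof -
      have "inverse ((l i)\<^sup>2) * (2 * exp (1 / 16 - A (i - 1) / (16 * S)))
          \<le> E * K powr (2 * p + 2) * (1 / (real (i - 1))\<^sup>2)" if i: "i \<in> G" for i
      proof -
        define n where "n = i - 1"
        have n: "i = n + 1" "M \<le> real n" "n \<le> D" "1 \<le> n" "i \<in> {1..D}"
          using i M1 by (auto simp: G_def n_def)
        have n0: "real n > 0" using n by simp
        have "inverse ((l i)\<^sup>2) \<le> C\<^sub>A\<^sup>2 * real i powr (2 * p)" by (rule inverse_square_bounds(1)[OF set C\<^sub>A n(5)])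
        also have "\<dots> \<le> C\<^sub>A\<^sup>2 * (2 * real n) powr (2 * p)"
          using n p by (intro mult_left_mono powr_mono2) auto
        finally have 1: "inverse ((l i)\<^sup>2) \<le> C\<^sub>A\<^sup>2 * (2 powr (2 * p) * real n powr (2 * p))"
          by (simp add: powr_mult)
        (* the exponent r is chosen so that the tail decays like (K / n) powr (2 * p + 2), two powers
           faster than the variances grow; one of them is lost by summation *)
        define x where "x = (real n / K) powr \<beta> / (16 * c)"
        have x0: "x > 0" using n0 K c1 by (simp add: x_def)
        have "x * (16 * S) = real n powr \<beta> / c"
          using K c1 S n0 by (simp add: x_def powr_divide)
        also have "\<dots> \<le> A n" using A_ge[OF n(3)] c1 by (simp add: field_simps)
        finally have "x \<le> A n / (16 * S)" using S by (simp add: pos_le_divide_eq)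
        then have "exp (- (A n / (16 * S))) \<le> exp (- x)" by simp
        also have "\<dots> \<le> (r / x) powr r" by (rule exp_minus_le_powr[OF x0 r0])
        also have "\<dots> = (16 * c * r) powr r * (K / real n) powr (2 * p + 2)"
        proof -
          have "r / x = 16 * c * r * (K / real n) powr \<beta>"
            using n0 K c1 by (simp add: x_def powr_divide field_simps)
          moreover have "\<beta> * r = 2 * p + 2" using \<beta> by (simp add: r_def)
          ultimately show ?thesis using n0 K c1 r0 by (simp add: powr_mult powr_powr)
        qed
        finally have 2: "exp (1 / 16 - A n / (16 * S)) \<le> exp (1 / 16) * ((16 * c * r) powr r * (K / real n) powr (2 * p + 2))"
          unfolding diff_conv_add_uminus exp_add by (rule mult_left_mono) simp
        have "inverse ((l i)\<^sup>2) * (2 * exp (1 / 16 - A n / (16 * S)))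
            \<le> (C\<^sub>A\<^sup>2 * (2 powr (2 * p) * real n powr (2 * p))) *
              (2 * (exp (1 / 16) * ((16 * c * r) powr r * (K / real n) powr (2 * p + 2))))"
          using 1 2 by (intro mult_mono mult_left_mono) auto
        also have "\<dots> = E * (real n powr (2 * p) * (K / real n) powr (2 * p + 2))"
          by (simp add: E_def mult_ac)
        also have "real n powr (2 * p) * (K / real n) powr (2 * p + 2) = K powr (2 * p + 2) * (1 / (real n)\<^sup>2)"
          using n0 K powr_realpow[of "real n" 2] by (simp add: powr_divide powr_add)
        finally show ?thesis by (simp add: n_def mult.assoc)
      qed
      then have "(\<Sum>i\<in>G. inverse ((l i)\<^sup>2) * (2 * exp (1 / 16 - A (i - 1) / (16 * S))))
          \<le> E * K powr (2 * p + 2) * (\<Sum>i\<in>G. 1 / (real (i - 1))\<^sup>2)"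
        by (simp add: sum_distrib_left sum_mono)
      also have "(\<Sum>i\<in>G. 1 / (real (i - 1))\<^sup>2) = (\<Sum>n\<in>(\<lambda>i. i - 1) ` G. 1 / (real n)\<^sup>2)"
        by (subst sum.reindex) (auto simp: inj_on_def G_def)
      also have "\<dots> \<le> 2 / M"
        using M1 by (intro sum_inverse_square_tail) (auto simp: G_def)
      also have "\<dots> \<le> 2 / K"
      proof -
        have "K \<le> C1 * K" using C1 K by simp
        then have "K \<le> M" using CKM by linarith
        then show ?thesis using K M1 by (intro divide_left_mono) auto
      qed
      finally have "(\<Sum>i\<in>G. inverse ((l i)\<^sup>2) * (2 * exp (1 / 16 - A (i - 1) / (16 * S))))
          \<le> E * K powr (2 * p + 2) * (2 / K)" using N by (simp add: mult_left_mono)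
      also have "K powr (2 * p + 2) = K powr q * K"
      proof -
        have e: "2 * p + 2 = q + 1" by (simp add: q_def)
        show ?thesis unfolding e using K(1) by (simp add: powr_add)
      qed
      finally show ?thesis using K by simp
    qed
    ultimately have "stopped_risk \<alpha> D l 1 \<kappa> \<mu>
        \<le> B + N1 * (real k powr q + K powr q) + 2 * V + N2 * W + 2 * E * K powr q" by linarith
    also have "\<dots> = (1 + N2 * C2) * B + 2 * V + (N1 + N2) * real k powr q
        + (N1 + N2 * C1 powr q + 2 * E) * K powr q"
      using C1 K by (simp add: W_def powr_mult algebra_simps)
    also have "\<dots> \<le> (1 + N2 * C2) * B + 2 * V + (N1 + N2) * (q * C\<^sub>A\<^sup>2 * V)
        + (N1 + N2 * C1 powr q + 2 * E) * K powr q"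
      using mult_left_mono[OF k_le, of "N1 + N2"] N by simp
    also have "\<dots> = (1 + N2 * C2) * B + (2 + (N1 + N2) * (q * C\<^sub>A\<^sup>2)) * V
        + (N1 + N2 * C1 powr q + 2 * E) * K powr q" by (simp add: algebra_simps)
    also have "\<dots> \<le> Ctot * B + Ctot * V + Ctot * K powr q"
    proof -
      have "0 \<le> V" by (simp add: V_def sum_nonneg)
      moreover have "1 + N2 * C2 \<le> Ctot" "2 + (N1 + N2) * (q * C\<^sub>A\<^sup>2) \<le> Ctot"
        "N1 + N2 * C1 powr q + 2 * E \<le> Ctot"
      proof -
        have "0 \<le> N2 * C2" "0 \<le> (N1 + N2) * (q * C\<^sub>A\<^sup>2)" "0 \<le> N2 * C1 powr q"
          using N C2 q by auto
        then show "1 + N2 * C2 \<le> Ctot" "2 + (N1 + N2) * (q * C\<^sub>A\<^sup>2) \<le> Ctot"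
          "N1 + N2 * C1 powr q + 2 * E \<le> Ctot" using N unfolding Ctot_def by linarith+
      qed
      ultimately show ?thesis using B by (intro add_mono mult_right_mono) auto
    qed
    also have "\<dots> = Ctot * (B + V + S powr (q / \<beta>))" by (simp add: K_def powr_powr distrib_left)
    finally show ?thesis by (simp add: B_def V_def S_def q_def \<beta>_def)
  qed
  then show ?thesis using tot by blast
qed

section \<open>The risk at a deterministic index\<close>

lemma balanced_oracle_range:
  shows "balanced_oracle D l \<delta> \<mu> \<in> {0..real D}"
proof -
  let ?S = "{t \<in> {0..real D}. bias2 D \<mu> t \<le> variance_term l \<delta> t}"
  have D: "real D \<in> ?S"
    by (auto simp: bias2_def variance_term_def intro!: sum_nonneg)
  have b: "bdd_below ?S" by (rule bdd_belowI[of _ 0]) auto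
  have "Inf ?S \<le> real D" using D b by (rule cInf_lower)
  moreover have "0 \<le> Inf ?S" using D by (intro cInf_greatest) auto
  ultimately show ?thesis by (simp add: balanced_oracle_def)
qed

text \<open>
  The interpolation parameter is the success probability of the coin. For integer \<open>t\<close> it is \<open>0\<close> and
  both endpoints coincide.
\<close>

lemma risk_fixed_index_interpolates:
  assumes t: "t \<in> {0..real D}" and l: "\<forall>i\<in>{1..D}. l i > 0"
  obtains \<theta> m n where "0 \<le> \<theta>" "\<theta> \<le> 1" "m \<le> D" "n \<le> D" "t = (1 - \<theta>) * real m + \<theta> * real n"
    "risk D l 1 \<mu> (\<lambda>_. t) =
       (1 - \<theta>) * ((\<Sum>i=m+1..D. (\<mu> i)\<^sup>2) + (\<Sum>i=1..m. inverse ((l i)\<^sup>2)))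
       + \<theta> * ((\<Sum>i=n+1..D. (\<mu> i)\<^sup>2) + (\<Sum>i=1..n. inverse ((l i)\<^sup>2)))"
proof -
  define \<theta> where "\<theta> = t - of_int \<lfloor>t\<rfloor>"
  define m n where "m = nat \<lfloor>t\<rfloor>" and "n = nat \<lceil>t\<rceil>"
  have \<theta>: "0 \<le> \<theta>" "\<theta> \<le> 1" unfolding \<theta>_def by linarith+
  have tl: "0 \<le> \<lfloor>t\<rfloor>" "0 \<le> \<lceil>t\<rceil>" "\<lceil>t\<rceil> \<le> int D" "\<lfloor>t\<rfloor> \<le> int D" 
    using t unfolding atLeastAtMost_iff by linarith+
  have mn: "int m = \<lfloor>t\<rfloor>" "int n = \<lceil>t\<rceil>" "m \<le> D" "n \<le> D"
  proof -
    show mn': "int m = \<lfloor>t\<rfloor>" "int n = \<lceil>t\<rceil>" using tl by (simp_all add: m_def n_def)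
    show "m \<le> D" "n \<le> D" using tl mn' by linarith+
  qed
  have cases: "\<theta> = 0 \<and> n = m \<or> n = m + 1"
  proof (cases "t = of_int \<lfloor>t\<rfloor>")
    case True
    then have "\<lceil>t\<rceil> = \<lfloor>t\<rfloor>" by (metis ceiling_of_int)
    then show ?thesis using True mn by (simp add: \<theta>_def)
  next
    case False
    then have "\<lceil>t\<rceil> = \<lfloor>t\<rfloor> + 1" by (simp add: ceiling_altdef)
    then show ?thesis using mn by linarith
  qed
  have "real_of_int \<lfloor>t\<rfloor> = real m" unfolding mn(1)[symmetric] by simp
  then have tm: "t = real m + \<theta>" by (simp add: \<theta>_def)
  let ?f = "\<lambda>k. \<Sum>i=1..D. of_bool (i \<le> k) * inverse ((l i)\<^sup>2) + (1 - of_bool (i \<le> k)) * (\<mu> i)\<^sup>2"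
  have f: "?f k = (\<Sum>i=k+1..D. (\<mu> i)\<^sup>2) + (\<Sum>i=1..k. inverse ((l i)\<^sup>2))" if "k \<le> D" for k
  proof -
    have "?f k = (\<Sum>i=1..D. if i \<le> k then inverse ((l i)\<^sup>2) else (\<mu> i)\<^sup>2)"
      by (intro sum.cong refl) auto
    moreover have "{1..D} \<inter> {i. i \<le> k} = {1..k}" "{1..D} \<inter> - {i. i \<le> k} = {k+1..D}" using that by auto
    ultimately show ?thesis by (simp add: sum.If_cases)
  qed
  have weight: "(of_bool (int i \<le> \<lfloor>t\<rfloor>) + (t - of_int \<lfloor>t\<rfloor>) * of_bool (int i = \<lceil>t\<rceil>) :: real)
      = (1 - \<theta>) * of_bool (i \<le> m) + \<theta> * of_bool (i \<le> n)" for i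
    using cases unfolding \<theta>_def[symmetric] unfolding mn(1,2)[symmetric] by auto
  have "risk D l 1 \<mu> (\<lambda>_. t) = (\<Sum>i=1..D.
      ((1 - \<theta>) * of_bool (i \<le> m) + \<theta> * of_bool (i \<le> n)) * inverse ((l i)\<^sup>2)
      + (1 - ((1 - \<theta>) * of_bool (i \<le> m) + \<theta> * of_bool (i \<le> n))) * (\<mu> i)\<^sup>2)"
    using risk_fixed_index[OF t, of l \<mu>] l unfolding weight by simp
  also have "\<dots> = (1 - \<theta>) * ?f m + \<theta> * ?f n"
    unfolding sum_distrib_left sum.distrib[symmetric]
    by (intro sum.cong refl) (simp add: algebra_simps)
  finally have "risk D l 1 \<mu> (\<lambda>_. t) = (1 - \<theta>) * ?f m + \<theta> * ?f n" .
  moreover have "t = (1 - \<theta>) * real m + \<theta> * real n"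
    using cases tm by (auto simp: algebra_simps)
  ultimately show ?thesis
    using that[OF \<theta> mn(3,4)] unfolding f[OF mn(3)] f[OF mn(4)] by blast
qed

text \<open>
  A convex combination is at least the smaller of its endpoints.
\<close>

lemma risk_fixed_index_ge_integer:
  assumes t: "t \<in> {0..real D}" and l: "\<forall>i\<in>{1..D}. l i > 0"
  obtains k where "k \<le> D"
    "(\<Sum>i=k+1..D. (\<mu> i)\<^sup>2) + (\<Sum>i=1..k. inverse ((l i)\<^sup>2)) \<le> risk D l 1 \<mu> (\<lambda>_. t)"
proof -
  obtain \<theta> m n where \<theta>: "0 \<le> \<theta>" "\<theta> \<le> 1" and mn: "m \<le> D" "n \<le> D"
    and "t = (1 - \<theta>) * real m + \<theta> * real n"
    and r: "risk D l 1 \<mu> (\<lambda>_. t) =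
       (1 - \<theta>) * ((\<Sum>i=m+1..D. (\<mu> i)\<^sup>2) + (\<Sum>i=1..m. inverse ((l i)\<^sup>2)))
       + \<theta> * ((\<Sum>i=n+1..D. (\<mu> i)\<^sup>2) + (\<Sum>i=1..n. inverse ((l i)\<^sup>2)))"
    by (rule risk_fixed_index_interpolates[where \<mu> = \<mu>, OF t l])
  have min: "min x y \<le> (1 - \<theta>) * x + \<theta> * y" for x y :: real
  proof -
    have "(1 - \<theta>) * min x y + \<theta> * min x y \<le> (1 - \<theta>) * x + \<theta> * y"
      using \<theta> by (intro add_mono mult_left_mono) auto
    then show ?thesis by (simp add: algebra_simps)
  qed
  show ?thesis
    using that[OF mn(1)] that[OF mn(2)]
      min[of "(\<Sum>i=m+1..D. (\<mu> i)\<^sup>2) + (\<Sum>i=1..m. inverse ((l i)\<^sup>2))"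
        "(\<Sum>i=n+1..D. (\<mu> i)\<^sup>2) + (\<Sum>i=1..n. inverse ((l i)\<^sup>2))"]
    unfolding r min_le_iff_disj by blast
qed

text \<open>
  Interpolating the powers of the neighbouring integers overestimates the power of \<open>t\<close>, by convexity,
  and interpolating their variances underestimates the risk. This makes the remainder term comparable
  to the oracle risk when the balanced oracle is large.
\<close>

lemma power_index_le_risk:
  assumes set: "setting p C\<^sub>A C\<^sub>\<kappa> \<alpha> D 1 l \<kappa>" and p: "p \<ge> 0" and C\<^sub>A: "C\<^sub>A \<ge> 1" and t: "t \<in> {0..real D}"
  shows "t powr (2 * p + 1) \<le> (2 * p + 1) * C\<^sub>A\<^sup>2 * risk D l 1 \<mu> (\<lambda>_. t)"
proof -
  define q where "q = 2 * p + 1"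
  have q: "q \<ge> 1" using p by (simp add: q_def)
  have pos: "\<forall>i\<in>{1..D}. l i > 0" using set by (simp add: setting_def)
  obtain \<theta> m n where \<theta>: "0 \<le> \<theta>" "\<theta> \<le> 1" and mn: "m \<le> D" "n \<le> D"
    and tmn: "t = (1 - \<theta>) * real m + \<theta> * real n"
    and r: "risk D l 1 \<mu> (\<lambda>_. t) =
       (1 - \<theta>) * ((\<Sum>i=m+1..D. (\<mu> i)\<^sup>2) + (\<Sum>i=1..m. inverse ((l i)\<^sup>2)))
       + \<theta> * ((\<Sum>i=n+1..D. (\<mu> i)\<^sup>2) + (\<Sum>i=1..n. inverse ((l i)\<^sup>2)))"
    by (rule risk_fixed_index_interpolates[where \<mu> = \<mu>, OF t pos])
  have V: "real k powr q \<le> (q * C\<^sub>A\<^sup>2) * ((\<Sum>i=k+1..D. (\<mu> i)\<^sup>2) + (\<Sum>i=1..k. inverse ((l i)\<^sup>2)))"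
    if k: "k \<le> D" for k
  proof -
    have "real k powr q \<le> (q * C\<^sub>A\<^sup>2) * (\<Sum>i=1..k. inverse ((l i)\<^sup>2))"
      using index_powr_le_variance[OF set p C\<^sub>A k] by (simp add: q_def)
    also have "\<dots> \<le> (q * C\<^sub>A\<^sup>2) * ((\<Sum>i=k+1..D. (\<mu> i)\<^sup>2) + (\<Sum>i=1..k. inverse ((l i)\<^sup>2)))"
      using q by (intro mult_left_mono) (auto simp: sum_nonneg)
    finally show ?thesis .
  qed
  have "t powr q \<le> (1 - \<theta>) * real m powr q + \<theta> * real n powr q"
    unfolding tmn using q \<theta> by (intro powr_convex_combination) auto
  also have "\<dots> \<le> (1 - \<theta>) * ((q * C\<^sub>A\<^sup>2) * ((\<Sum>i=m+1..D. (\<mu> i)\<^sup>2) + (\<Sum>i=1..m. inverse ((l i)\<^sup>2))))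
      + \<theta> * ((q * C\<^sub>A\<^sup>2) * ((\<Sum>i=n+1..D. (\<mu> i)\<^sup>2) + (\<Sum>i=1..n. inverse ((l i)\<^sup>2))))"
    using \<theta> by (intro add_mono mult_left_mono V mn) auto
  also have "\<dots> = (q * C\<^sub>A\<^sup>2) * risk D l 1 \<mu> (\<lambda>_. t)"
    unfolding r by (simp add: algebra_simps)
  finally show ?thesis by (simp only: q_def)
qed

section \<open>Reduction to unit noise level\<close>

lemma risk_rescale:
  assumes "\<delta> > 0"
  shows "risk D l \<delta> \<mu> T = \<delta>\<^sup>2 * risk D l 1 (\<lambda>i. \<mu> i / \<delta>) (\<lambda>Y. T (\<lambda>i. \<delta> * Y i))"
proof -
  have obs: "observation l \<delta> \<mu> e = (\<lambda>i. \<delta> * observation l 1 (\<lambda>i. \<mu> i / \<delta>) e i)" for e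
    using assms by (simp add: observation_def fun_eq_iff field_simps)
  have "loss D l \<delta> \<mu> T e x = \<delta>\<^sup>2 * loss D l 1 (\<lambda>i. \<mu> i / \<delta>) (\<lambda>Y. T (\<lambda>i. \<delta> * Y i)) e x" for e x
    unfolding loss_eq_sum obs sum_distrib_left estimator_def
    using assms by (intro sum.cong refl) (simp add: field_simps flip: power_mult_distrib)
  then show ?thesis unfolding risk_def case_prod_beta by (simp only: integral_mult_right_zero)
qed

lemma stopping_time_rescale:
  assumes "\<delta> > 0"
  shows "stopping_time \<alpha> D l \<kappa> (\<lambda>i. \<delta> * Y i) = stopping_time \<alpha> D l (\<kappa> / \<delta>\<^sup>2) Y"
proof -
  have "residual \<alpha> D l (\<lambda>i. \<delta> * Y i) m = \<delta>\<^sup>2 * residual \<alpha> D l Y m" for m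
    unfolding residual_def by (simp add: sum_distrib_left power_mult_distrib mult_ac)
  then have "residual \<alpha> D l (\<lambda>i. \<delta> * Y i) m \<le> \<kappa> \<longleftrightarrow> residual \<alpha> D l Y m \<le> \<kappa> / \<delta>\<^sup>2" for m
    using assms by (simp add: field_simps)
  then show ?thesis unfolding stopping_time_def by simp
qed

lemma setting_rescale:
  assumes "setting p C\<^sub>A C\<^sub>\<kappa> \<alpha> D \<delta> l \<kappa>"
  shows "setting p C\<^sub>A C\<^sub>\<kappa> \<alpha> D 1 l (\<kappa> / \<delta>\<^sup>2)"
proof -
  have \<delta>: "\<delta> > 0" using assms by (simp add: setting_def)
  let ?A = "\<Sum>i=1..D. l i powr (2 * \<alpha>)"
  have "\<bar>\<kappa> - ?A * \<delta>\<^sup>2\<bar> = \<bar>\<kappa> / \<delta>\<^sup>2 - ?A\<bar> * \<delta>\<^sup>2"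
  proof -
    have "\<kappa> - ?A * \<delta>\<^sup>2 = (\<kappa> / \<delta>\<^sup>2 - ?A) * \<delta>\<^sup>2" using \<delta> by (simp add: field_simps)
    then show ?thesis by (simp add: abs_mult)
  qed
  moreover have "\<bar>\<kappa> - ?A * \<delta>\<^sup>2\<bar> \<le> C\<^sub>\<kappa> * s_D \<alpha> D l * \<delta>\<^sup>2"
    using assms by (simp add: setting_def sum_distrib_right)
  ultimately have "\<bar>\<kappa> / \<delta>\<^sup>2 - ?A\<bar> \<le> C\<^sub>\<kappa> * s_D \<alpha> D l" using \<delta> by simp
  then show ?thesis using assms \<delta> by (simp add: setting_def)
qed

section \<open>The oracle inequality\<close>

theorem theorem2p2:
  fixes p C\<^sub>A C\<^sub>\<kappa> \<alpha> :: real
  assumes "p \<ge> 0" and "C\<^sub>A \<ge> 1" and "C\<^sub>\<kappa> > 0" and "\<alpha> \<ge> 0" and "\<alpha> * p < 1 / 2"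
  shows
    "(\<exists>C>0. \<forall>D \<delta> l \<kappa> \<mu>. setting p C\<^sub>A C\<^sub>\<kappa> \<alpha> D \<delta> l \<kappa> \<longrightarrow>
        stopped_risk \<alpha> D l \<delta> \<kappa> \<mu>
          \<le> C * (oracle_risk D l \<delta> \<mu>
                 + s_D \<alpha> D l powr ((2 * p + 1) / (1 - 2 * \<alpha> * p)) * \<delta>\<^sup>2))
     \<and> (\<forall>c>0. \<exists>C'>0. \<forall>D \<delta> l \<kappa> \<mu>. setting p C\<^sub>A C\<^sub>\<kappa> \<alpha> D \<delta> l \<kappa> \<longrightarrow>
        balanced_oracle D l \<delta> \<mu> \<ge> c * s_D \<alpha> D l powr (1 / (1 - 2 * \<alpha> * p)) \<longrightarrow>
        stopped_risk \<alpha> D l \<delta> \<kappa> \<mu> \<le> C' * oracle_risk D l \<delta> \<mu>)"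
proof -
  let ?q = "2 * p + 1"
  let ?K = "\<lambda>D l. s_D \<alpha> D l powr (?q / (1 - 2 * \<alpha> * p))"
  obtain C where C: "C > 0" and "\<forall>D l \<kappa> \<mu> k. setting p C\<^sub>A C\<^sub>\<kappa> \<alpha> D 1 l \<kappa> \<longrightarrow> k \<le> D \<longrightarrow>
      stopped_risk \<alpha> D l 1 \<kappa> \<mu>
        \<le> C * ((\<Sum>i=k+1..D. (\<mu> i)\<^sup>2) + (\<Sum>i=1..k. inverse ((l i)\<^sup>2)) + ?K D l)"
    using stopped_risk_rate[OF assms] by blast
  then have rate: "stopped_risk \<alpha> D l 1 \<kappa> \<mu>
        \<le> C * ((\<Sum>i=k+1..D. (\<mu> i)\<^sup>2) + (\<Sum>i=1..k. inverse ((l i)\<^sup>2)) + ?K D l)"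
    if "setting p C\<^sub>A C\<^sub>\<kappa> \<alpha> D 1 l \<kappa>" "k \<le> D" for D l \<kappa> \<mu> k
    using that by blast

  have first: "stopped_risk \<alpha> D l \<delta> \<kappa> \<mu> \<le> C * (oracle_risk D l \<delta> \<mu> + ?K D l * \<delta>\<^sup>2)"
    if set: "setting p C\<^sub>A C\<^sub>\<kappa> \<alpha> D \<delta> l \<kappa>" for D \<delta> l \<kappa> \<mu>
  proof -
    have \<delta>: "\<delta> > 0" and pos: "\<forall>i\<in>{1..D}. l i > 0" using set by (auto simp: setting_def)
    let ?t = "balanced_oracle D l \<delta> \<mu>" and ?\<mu> = "\<lambda>i. \<mu> i / \<delta>"
    obtain k where k: "k \<le> D"
      "(\<Sum>i=k+1..D. (?\<mu> i)\<^sup>2) + (\<Sum>i=1..k. inverse ((l i)\<^sup>2)) \<le> risk D l 1 ?\<mu> (\<lambda>_. ?t)"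
      using risk_fixed_index_ge_integer[where \<mu> = ?\<mu> and l = l, OF balanced_oracle_range pos] by blast
    have "stopped_risk \<alpha> D l 1 (\<kappa> / \<delta>\<^sup>2) ?\<mu> \<le> C * (risk D l 1 ?\<mu> (\<lambda>_. ?t) + ?K D l)"
      using rate[OF setting_rescale[OF set] k(1), of ?\<mu>] k(2) C
      by (elim order_trans) (intro mult_left_mono add_right_mono, auto)
    then have "\<delta>\<^sup>2 * stopped_risk \<alpha> D l 1 (\<kappa> / \<delta>\<^sup>2) ?\<mu> \<le> \<delta>\<^sup>2 * (C * (risk D l 1 ?\<mu> (\<lambda>_. ?t) + ?K D l))"
      by (rule mult_left_mono) simp
    then show ?thesis
      unfolding stopped_risk_def oracle_risk_def risk_rescale[OF \<delta>, of D l \<mu>] stopping_time_rescale[OF \<delta>]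
      by (simp add: algebra_simps)
  qed

  have second: "?K D l * \<delta>\<^sup>2 \<le> (?q * C\<^sub>A\<^sup>2 / c powr ?q) * oracle_risk D l \<delta> \<mu>"
    if set: "setting p C\<^sub>A C\<^sub>\<kappa> \<alpha> D \<delta> l \<kappa>" and c: "c > 0"
      and t: "balanced_oracle D l \<delta> \<mu> \<ge> c * s_D \<alpha> D l powr (1 / (1 - 2 * \<alpha> * p))" for D \<delta> l \<kappa> \<mu> c
  proof -
    have \<delta>: "\<delta> > 0" using set by (simp add: setting_def)
    let ?t = "balanced_oracle D l \<delta> \<mu>" and ?\<mu> = "\<lambda>i. \<mu> i / \<delta>"
    have "(c * s_D \<alpha> D l powr (1 / (1 - 2 * \<alpha> * p))) powr ?q \<le> ?t powr ?q"
      using t c assms(1) by (intro powr_mono2) auto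
    also have "\<dots> \<le> ?q * C\<^sub>A\<^sup>2 * risk D l 1 ?\<mu> (\<lambda>_. ?t)"
      by (rule power_index_le_risk[OF setting_rescale[OF set] assms(1,2) balanced_oracle_range])
    finally have "c powr ?q * ?K D l \<le> ?q * C\<^sub>A\<^sup>2 * risk D l 1 ?\<mu> (\<lambda>_. ?t)"
      using c by (simp add: powr_mult powr_powr)
    then have "?K D l \<le> (?q * C\<^sub>A\<^sup>2 / c powr ?q) * risk D l 1 ?\<mu> (\<lambda>_. ?t)"
      using c by (simp add: pos_le_divide_eq mult.commute)
    then have "?K D l * \<delta>\<^sup>2 \<le> (?q * C\<^sub>A\<^sup>2 / c powr ?q) * risk D l 1 ?\<mu> (\<lambda>_. ?t) * \<delta>\<^sup>2"
      by (rule mult_right_mono) simp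
    then show ?thesis unfolding oracle_risk_def risk_rescale[OF \<delta>, of D l \<mu>] by (simp add: mult_ac)
  qed

  have "\<exists>C'>0. \<forall>D \<delta> l \<kappa> \<mu>. setting p C\<^sub>A C\<^sub>\<kappa> \<alpha> D \<delta> l \<kappa> \<longrightarrow>
        balanced_oracle D l \<delta> \<mu> \<ge> c * s_D \<alpha> D l powr (1 / (1 - 2 * \<alpha> * p)) \<longrightarrow>
        stopped_risk \<alpha> D l \<delta> \<kappa> \<mu> \<le> C' * oracle_risk D l \<delta> \<mu>" if c: "c > 0" for c
  proof (intro exI[of _ "C * (1 + ?q * C\<^sub>A\<^sup>2 / c powr ?q)"] conjI allI impI)
    show "0 < C * (1 + ?q * C\<^sub>A\<^sup>2 / c powr ?q)"
      using C assms(1) by (intro mult_pos_pos add_pos_nonneg) auto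
    fix D \<delta> l \<kappa> \<mu>
    assume "setting p C\<^sub>A C\<^sub>\<kappa> \<alpha> D \<delta> l \<kappa>"
      and "balanced_oracle D l \<delta> \<mu> \<ge> c * s_D \<alpha> D l powr (1 / (1 - 2 * \<alpha> * p))"
    then have "C * (oracle_risk D l \<delta> \<mu> + ?K D l * \<delta>\<^sup>2)
        \<le> C * (oracle_risk D l \<delta> \<mu> + (?q * C\<^sub>A\<^sup>2 / c powr ?q) * oracle_risk D l \<delta> \<mu>)"
      using C c second by (intro mult_left_mono add_left_mono) auto
    with first[OF \<open>setting p C\<^sub>A C\<^sub>\<kappa> \<alpha> D \<delta> l \<kappa>\<close>, of \<mu>]
    show "stopped_risk \<alpha> D l \<delta> \<kappa> \<mu> \<le> C * (1 + ?q * C\<^sub>A\<^sup>2 / c powr ?q) * oracle_risk D l \<delta> \<mu>"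
      by (elim order_trans) (simp add: algebra_simps)
  qed
  with first C show ?thesis by blast
qed

end
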